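(* Let $J=(a_0,+\infty)$ with $a_0\in\mathbb{R}\cup\{-\infty\}$, let $h\colon J\to(0,+\infty)$ be a differentiable growth rate with associated group $(J,\ast)$ and unit element $e_\ast=h^{-1}(1)$, let $T>e_\ast$, and let $A\colon J\to M_n(\mathbb{R})$ be continuous. Assume that $h'$ does not vanish on $J$ and that $$(t\ast T)'A(t\ast T)=\frac{h'(t)h(T)}{h'(t\ast T)}A(t\ast T)=A(t)\quad\text{for all } t\in J .$$ Let $V$ be the monodromy matrix of the system $x'=A(t)x$, $t\in J$. Then the following properties are equivalent: i) no eigenvalue of the monodromy matrix $V$ lies on the unit circle $\{z\in\mathbb{C}:|z|=1\}$; ii) the linear system $x'=A(t)x$ has a uniform $h$-dichotomy on $J$.
   Context: Fix a norm on $\mathbb{R}^n$ with induced matrix norm $\|\cdot\|$. $\Phi(t,s)$ denotes the transition matrix of $x'=A(t)x$. Growth rate: a strictly increasing homeomorphism $h\colon J=(a_0,+\infty)\to(0,+\infty)$; it is a differentiable growth rate if moreover $h$ is differentiable on $J$. Group $(J,\ast)$: $t\ast s:=h^{-1}(h(t)h(s))$, with unit $e_\ast=h^{-1}(1)$ and inverse $t^{\ast-1}=h^{-1}(1/h(t))$. $(t\ast T)'$ denotes the derivative of $t\mapsto t\ast T$. Monodromy matrix: under the displayed condition on $A$, if $\Phi(t)$ is a fundamental matrix of $x'=A(t)x$ then $t\mapsto\Phi(t\ast T)$ is also a fundamental matrix, hence there is a nonsingular constant matrix $V$ with $\Phi(t\ast T)=\Phi(t)V$ for all $t\in J$; $V$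 is called the monodromy matrix (a different choice of $\Phi$ replaces $V$ by a similar matrix, so its eigenvalues do not depend on $\Phi$). Uniform $h$-dichotomy on $J$: there exist projectors $P(t)$ ($P(t)^2=P(t)$), $t\in J$, and constants $K\ge1$, $\alpha>0$ such that $P(t)\Phi(t,s)=\Phi(t,s)P(s)$ for all $t,s\in J$; $\|\Phi(t,s)P(s)\|\le K(h(t)/h(s))^{-\alpha}$ for all $t\ge s$ in $J$; and $\|\Phi(t,s)(I-P(s))\|\le K(h(s)/h(t))^{-\alpha}$ for all $s\ge t$ in $J$. *)

theory Defs
  imports "HOL-Analysis.Analysis"
begin

definition is_norm :: "('a::real_vector \<Rightarrow> real) \<Rightarrow> bool" where
  "is_norm nrm \<longleftrightarrow>
     (\<forall>x. 0 \<le> nrm x) \<and> (\<forall>x. nrm x = 0 \<longleftrightarrow> x = 0) \<and>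
     (\<forall>c x. nrm (c *\<^sub>R x) = \<bar>c\<bar> * nrm x) \<and>
     (\<forall>x y. nrm (x + y) \<le> nrm x + nrm y)"

text \<open>The operator norm with respect to an arbitrary vector norm, in the form of the
  library's \<^const>\<open>onorm\<close>; the zero vector contributes only the value 0.\<close>

definition induced_norm :: "(real^'n \<Rightarrow> real) \<Rightarrow> real^'n^'n \<Rightarrow> real" where
  "induced_norm nrm M = (SUP x. nrm (M *v x) / nrm x)"

definition complex_eigenvalue :: "real^'n^'n \<Rightarrow> complex \<Rightarrow> bool" where
  "complex_eigenvalue M z \<longleftrightarrow>
     (\<exists>v :: complex^'n. v \<noteq> 0 \<and> map_matrix complex_of_real M *v v = z *s v)"

definition differentiable_growth_rate :: "real set \<Rightarrow> (real \<Rightarrow> real) \<Rightarrow> bool" where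
  "differentiable_growth_rate J h \<longleftrightarrow>
     strict_mono_on J h \<and> (\<exists>g. homeomorphism J {0<..} h g) \<and> (\<forall>t\<in>J. h differentiable (at t))"

definition growth_mult :: "real set \<Rightarrow> (real \<Rightarrow> real) \<Rightarrow> real \<Rightarrow> real \<Rightarrow> real" where
  "growth_mult J h t s = inv_into J h (h t * h s)"

definition growth_unit :: "real set \<Rightarrow> (real \<Rightarrow> real) \<Rightarrow> real" where
  "growth_unit J h = inv_into J h 1"

definition fundamental_matrix ::
    "real set \<Rightarrow> (real \<Rightarrow> real^'n^'n) \<Rightarrow> (real \<Rightarrow> real^'n^'n) \<Rightarrow> bool" where
  "fundamental_matrix J A X \<longleftrightarrow>
     (\<forall>t\<in>J. (X has_vector_derivative A t ** X t) (at t) \<and> invertible (X t))"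

text \<open>The product below does not depend on the choice of the fundamental matrix \<open>X\<close>. It is
  meaningful only for \<open>t, s \<in> J\<close>.\<close>

definition transition_matrix ::
    "real set \<Rightarrow> (real \<Rightarrow> real^'n^'n) \<Rightarrow> real \<Rightarrow> real \<Rightarrow> real^'n^'n" where
  "transition_matrix J A t s =
     (THE M. \<exists>X. fundamental_matrix J A X \<and> M = X t ** matrix_inv (X s))"

text \<open>A monodromy matrix is determined only up to similarity, by the choice of the
  fundamental matrix \<open>X\<close>; hence a predicate rather than a function.\<close>

definition monodromy_matrix ::
    "real set \<Rightarrow> (real \<Rightarrow> real) \<Rightarrow> real \<Rightarrow> (real \<Rightarrow> real^'n^'n) \<Rightarrow> real^'n^'n \<Rightarrow> bool" where
  "monodromy_matrix J h T A V \<longleftrightarrow>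
     invertible V \<and>
     (\<exists>X. fundamental_matrix J A X \<and> (\<forall>t\<in>J. X (growth_mult J h t T) = X t ** V))"

definition uniform_dichotomy ::
    "(real^'n \<Rightarrow> real) \<Rightarrow> real set \<Rightarrow> (real \<Rightarrow> real) \<Rightarrow> (real \<Rightarrow> real^'n^'n) \<Rightarrow> bool" where
  "uniform_dichotomy nrm J h A \<longleftrightarrow>
     (\<exists>(P :: real \<Rightarrow> real^'n^'n) (K :: real) (\<alpha> :: real).
        K \<ge> 1 \<and> \<alpha> > 0 \<and>
        (\<forall>t\<in>J. P t ** P t = P t) \<and>
        (\<forall>t\<in>J. \<forall>s\<in>J. P t ** transition_matrix J A t s = transition_matrix J A t s ** P s) \<and>
        (\<forall>t\<in>J. \<forall>s\<in>J. t \<ge> s \<longrightarrow>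
           induced_norm nrm (transition_matrix J A t s ** P s) \<le> K * (h t / h s) powr (- \<alpha>)) \<and>
        (\<forall>t\<in>J. \<forall>s\<in>J. s \<ge> t \<longrightarrow>
           induced_norm nrm (transition_matrix J A t s ** (mat 1 - P s))
             \<le> K * (h s / h t) powr (- \<alpha>)))"

end

theory Submission
  imports Defs "HOL-Computational_Algebra.Fundamental_Theorem_Algebra"
begin

text \<open>In the variable \<open>y = h t\<close> the group operation becomes multiplication, so a fundamental
  matrix \<open>X\<close> yields a family \<open>Z y = X (h\<inverse> y)\<close> with \<open>Z (\<theta> y) = Z y V\<close>, where
  \<open>\<theta> = h T > 1\<close>. If \<open>V\<close> has no eigenvalue on the unit circle, let \<open>P\<close> be the projection
  commuting with \<open>V\<close> for which \<open>V\<^sup>n P\<close> and \<open>V\<^sup>-\<^sup>n (I - P)\<close> decay exponentially; then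
  \<open>X t P (X t)\<inverse>\<close> is a dichotomy projection, since modulo periods only a compact range of
  \<open>y\<close> matters. Conversely, iterating over the periods, a dichotomy forces an eigenvector
  for an eigenvalue of modulus one first into the range of \<open>P\<close> and then to be zero.

  The projection is found without Jordan forms: a polynomial annihilating \<open>V\<close> is removed
  one linear factor \<open>V - z\<close> at a time from \<open>p(V) Y = 0\<close>, splitting \<open>Y\<close> into a forward and a
  backward decaying part at each step.\<close>

subsection \<open>Matrix algebra\<close>

lemma matrix_inv:
  assumes "invertible M"
  shows matrix_inv_right: "M ** matrix_inv M = mat 1"
    and matrix_inv_left: "matrix_inv M ** M = mat 1"
  using someI_ex[OF assms[unfolded invertible_def]] by (simp_all add: matrix_inv_def)

lemma matrix_inv_unique:
  fixes M :: "'a::field^'n^'n"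
  assumes "M ** N = mat 1"
  shows "matrix_inv M = N"
proof -
  have "invertible M" using assms invertible_right_inverse by blast
  then have "matrix_inv M ** (M ** N) = N" by (simp add: matrix_mul_assoc matrix_inv)
  then show ?thesis using assms by simp
qed

lemma matrix_diff_ldistrib: "A ** (B - C) = A ** B - A ** (C::'a::ring_1^'n^'m)"
  by (vector matrix_matrix_mult_def right_diff_distrib sum_subtractf)

lemma matrix_diff_rdistrib: "(A - B) ** C = A ** C - B ** (C::'a::ring_1^'n^'m)"
  by (vector matrix_matrix_mult_def left_diff_distrib sum_subtractf)

lemma matrix_add_rdistrib: "(A + B) ** C = A ** C + B ** (C::'a::semiring_1^'n^'m)"
  by (vector matrix_matrix_mult_def distrib_right sum.distrib)

lemma bounded_bilinear_matrix_mult: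
  "bounded_bilinear (\<lambda>(A::'a::{euclidean_space,real_algebra_1}^'n^'m) (B::'a^'k^'n). A ** B)"
proof -
  have "bilinear (\<lambda>(A::'a^'n^'m) (B::'a^'k^'n). A ** B)"
    unfolding bilinear_def
    by (auto intro!: linearI simp: vec_eq_iff matrix_matrix_mult_def scaleR_sum_right
        sum.distrib distrib_left distrib_right)
  then show ?thesis by (simp add: bilinear_conv_bounded_bilinear)
qed

lemma bounded_bilinear_matrix_vector_mult:
  "bounded_bilinear (\<lambda>(A::'a::{euclidean_space,real_algebra_1}^'n^'m) (x::'a^'n). A *v x)"
proof -
  have "bilinear (\<lambda>(A::'a^'n^'m) (x::'a^'n). A *v x)"
    unfolding bilinear_def
    by (auto intro!: linearI simp: vec_eq_iff matrix_vector_mult_def scaleR_sum_right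
        sum.distrib distrib_left distrib_right)
  then show ?thesis by (simp add: bilinear_conv_bounded_bilinear)
qed

lemmas bounded_linear_matrix_mult_left =
  bounded_bilinear.bounded_linear_left[OF bounded_bilinear_matrix_mult]
lemmas bounded_linear_matrix_mult_right =
  bounded_bilinear.bounded_linear_right[OF bounded_bilinear_matrix_mult]

lemma mat_matrix_mult_nth: "(mat c ** M) $ i $ j = c * M $ i $ j"
  for M :: "'a::semiring_1^'k^'n"
  by (simp add: matrix_matrix_mult_def mat_def if_distrib[where f="\<lambda>x. x * _"] cong: if_cong)

lemma mat_commute: "mat c ** M = M ** mat c"
  for M :: "'a::comm_semiring_1^'k^'n"
  by (simp add: vec_eq_iff mat_matrix_mult_nth)
     (simp add: matrix_matrix_mult_def mat_def mult.commute if_distrib[where f="\<lambda>x. _ * x"] cong: if_cong)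

lemma mat_left_commute: "N ** (mat c ** M) = mat c ** (N ** M)"
  for M :: "'a::comm_semiring_1^'k^'n"
  by (simp only: matrix_mul_assoc mat_commute[of c N])

lemma mat_mult_mat: "mat c ** mat d = (mat (c * d) :: 'a::comm_semiring_1^'n^'n)"
  by (simp add: vec_eq_iff mat_matrix_mult_nth) (simp add: mat_def)

lemma mat_mult_vec: "mat c *v x = c *s x"
  for x :: "'a::semiring_1^'n"
  by (simp add: vec_eq_iff matrix_vector_mult_def mat_def if_distrib[where f="\<lambda>x. x * _"]
      cong: if_cong)

lemma norm_mat_mult: "norm (mat c ** M) = norm c * norm M"
  for M :: "complex^'k^'n"
proof -
  have "norm ((mat c ** M) $ i) = norm c * norm (M $ i)" for i
    by (simp add: norm_vec_def mat_matrix_mult_nth norm_mult L2_set_right_distrib)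
  then show ?thesis by (simp add: norm_vec_def[of "mat c ** M"] norm_vec_def[of M] L2_set_right_distrib)
qed

lemma mat_of_real_mult: "mat (complex_of_real c) ** M = c *\<^sub>R M"
  for M :: "complex^'k^'n"
  by (simp add: vec_eq_iff mat_matrix_mult_nth) (simp add: scaleR_conv_of_real)

text \<open>This is \<open>V^n Y\<close>. Carrying \<open>Y\<close> inside the recursion lets decay
  be asked of \<open>V^n Y\<close> for a matrix \<open>Y\<close> of interest, such as a projection,
  while \<open>V^n\<close> itself may grow.\<close>

primrec lpow :: "'a::semiring_1^'n^'n \<Rightarrow> nat \<Rightarrow> 'a^'k^'n \<Rightarrow> 'a^'k^'n" where
  "lpow V 0 Y = Y"
| "lpow V (Suc n) Y = V ** lpow V n Y"

lemma lpow_Suc2: "lpow V (Suc n) Y = lpow V n (V ** Y)"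
  by (induction n) auto

lemma lpow_mult_right: "lpow V n (Y ** Z) = lpow V n Y ** Z"
  by (induction n) (auto simp: matrix_mul_assoc)

lemma lpow_commute:
  assumes "V ** N = N ** V"
  shows "lpow V n (N ** Y) = N ** lpow V n Y"
  by (induction n) (auto simp: matrix_mul_assoc assms)

lemma lpow_add: "lpow V n (Y + Z) = lpow V n Y + lpow V n Z"
  by (induction n) (auto simp: matrix_add_ldistrib)

lemma lpow_diff: "lpow V n (Y - Z) = lpow V n Y - lpow V n (Z::'a::ring_1^'k^'n)"
  by (induction n) (auto simp: matrix_diff_ldistrib)

lemma lpow_scaleR: "lpow V n (c *\<^sub>R Y) = c *\<^sub>R lpow V n Y"
  for Y :: "'a::{euclidean_space,real_algebra_1}^'k^'n"
  by (induction n)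
     (auto simp: bounded_bilinear.scaleR_right[OF bounded_bilinear_matrix_mult])

subsection \<open>Exponentially decaying sequences\<close>

text \<open>The rate is kept strictly positive so that its logarithm is available when
  \<open>power_le_powr\<close> turns it into an exponent.\<close>

definition expdecay :: "(nat \<Rightarrow> 'a::real_normed_vector) \<Rightarrow> bool" where
  "expdecay a \<longleftrightarrow> (\<exists>C \<rho>. 0 \<le> C \<and> 0 < \<rho> \<and> \<rho> < 1 \<and> (\<forall>n. norm (a n) \<le> C * \<rho> ^ n))"

lemma expdecay_0: "expdecay (\<lambda>n. 0)"
  unfolding expdecay_def by (rule exI[of _ 0], rule exI[of _ "1/2"]) auto

text \<open>Taking the larger constant and the larger rate serves both sequences; the two dichotomy
  estimates thereby share one \<open>K\<close> and one exponent.\<close>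

lemma expdecay_common_rate:
  assumes "expdecay a" "expdecay b"
  obtains C \<rho> where "0 \<le> C" "0 < \<rho>" "\<rho> < 1"
    "\<And>n. norm (a n) \<le> C * \<rho> ^ n" "\<And>n. norm (b n) \<le> C * \<rho> ^ n"
proof -
  obtain C1 r1 where 1: "0 \<le> C1" "0 < r1" "r1 < 1" "\<And>n. norm (a n) \<le> C1 * r1 ^ n"
    using assms(1) unfolding expdecay_def by blast
  obtain C2 r2 where 2: "0 \<le> C2" "0 < r2" "r2 < 1" "\<And>n. norm (b n) \<le> C2 * r2 ^ n"
    using assms(2) unfolding expdecay_def by blast
  have "norm (a n) \<le> max C1 C2 * max r1 r2 ^ n" for n
    by (rule order_trans[OF 1(4)]) (use 1 in \<open>auto intro!: mult_mono power_mono\<close>)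
  moreover have "norm (b n) \<le> max C1 C2 * max r1 r2 ^ n" for n
    by (rule order_trans[OF 2(4)]) (use 2 in \<open>auto intro!: mult_mono power_mono\<close>)
  ultimately show thesis using that[of "max C1 C2" "max r1 r2"] 1 2 by auto
qed

lemma expdecay_le:
  assumes "expdecay b" "0 \<le> c" "\<And>n. norm (a n) \<le> c * norm (b n)"
  shows "expdecay a"
proof -
  obtain C r where 1: "0 \<le> C" "0 < r" "r < 1" "\<And>n. norm (b n) \<le> C * r ^ n"
    using assms(1) unfolding expdecay_def by blast
  have "norm (a n) \<le> (c * C) * r ^ n" for n
    using mult_left_mono[OF 1(4) \<open>0 \<le> c\<close>, of n] assms(3)[of n] by (simp add: mult.assoc)
  then show ?thesis unfolding expdecay_def using 1 \<open>0 \<le> c\<close>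
    by (intro exI[of _ "c*C"] exI[of _ r]) auto
qed

lemma expdecay_add:
  assumes "expdecay a" "expdecay b"
  shows "expdecay (\<lambda>n. a n + b n)"
proof -
  obtain C r where 1: "0 \<le> C" "0 < r" "r < 1"
    "\<And>n. norm (a n) \<le> C * r ^ n" "\<And>n. norm (b n) \<le> C * r ^ n"
    using expdecay_common_rate[OF assms] by blast
  have "norm (a n + b n) \<le> (2 * C) * r ^ n" for n
    using norm_triangle_ineq[of "a n" "b n"] 1(4)[of n] 1(5)[of n] by (simp add: algebra_simps)
  then show ?thesis unfolding expdecay_def using 1
    by (intro exI[of _ "2*C"] exI[of _ r]) auto
qed

lemma expdecay_bounded_linear:
  assumes "bounded_linear L" "expdecay a"
  shows "expdecay (\<lambda>n. L (a n))"
proof -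
  obtain K where "K \<ge> 0" "\<And>x. norm (L x) \<le> norm x * K"
    using bounded_linear.nonneg_bounded[OF assms(1)] by blast
  then show ?thesis using expdecay_le[OF assms(2), of K "\<lambda>n. L (a n)"] by (simp add: mult.commute)
qed

lemma expdecay_tendsto_0:
  assumes "expdecay a"
  shows "a \<longlonglongrightarrow> 0"
proof -
  obtain C r where 1: "0 \<le> C" "0 < r" "r < 1" "\<And>n. norm (a n) \<le> C * r ^ n"
    using assms(1) unfolding expdecay_def by blast
  have "(\<lambda>n. C * r ^ n) \<longlonglongrightarrow> C * 0"
    by (intro tendsto_intros LIMSEQ_realpow_zero) (use 1 in auto)
  then show ?thesis
    by (intro Lim_null_comparison[of a "\<lambda>n. C * r ^ n"]) (use 1(4) in auto)
qed

text \<open>A contraction driven by a decaying forcing term decays, at a rate \<open>s\<close>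
  chosen above both \<open>c\<close> and the rate of the forcing. The bound \<open>D * s ^ n\<close>
  reproduces itself once \<open>c * D + C\<close> is at most \<open>D * s\<close>.\<close>

lemma expdecay_recurrence:
  assumes "expdecay b" "0 \<le> c" "c < 1" "\<And>n. norm (a (Suc n)) \<le> c * norm (a n) + norm (b n)"
  shows "expdecay a"
proof -
  obtain C r where 1: "0 \<le> C" "0 < r" "r < 1" "\<And>n. norm (b n) \<le> C * r ^ n"
    using assms(1) unfolding expdecay_def by blast
  \<comment> \<open>The midpoint of \<open>c\<close> and 1 leaves a positive gap
    \<open>s - c\<close>, which absorbs the forcing term through the choice of \<open>D\<close>
    below.\<close>
  define s where "s = max r ((1 + c) / 2)"
  have s: "0 < s" "s < 1" "r \<le> s" "c < s" using 1 assms(2,3) by (auto simp: s_def less_max_iff_disj)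
  define D where "D = max (norm (a 0)) (C / (s - c))"
  have D: "C \<le> D * (s - c)" "0 \<le> D"
    using s pos_divide_le_eq[of "s - c" C D] by (auto simp: D_def le_max_iff_disj)
  have "norm (a n) \<le> D * s ^ n" for n
  proof (induction n)
    case 0 show ?case by (simp add: D_def)
  next
    case (Suc n)
    have "norm (b n) \<le> C * s ^ n"
      by (rule order_trans[OF 1(4)]) (use 1 s in \<open>auto intro!: mult_left_mono power_mono\<close>)
    also have "\<dots> \<le> D * (s - c) * s ^ n" using D s by (intro mult_right_mono) auto
    finally have "c * norm (a n) + norm (b n) \<le> c * (D * s ^ n) + D * (s - c) * s ^ n"
      using mult_left_mono[OF Suc.IH assms(2)] by linarith
    also have "\<dots> = D * s ^ Suc n" by (simp add: algebra_simps)
    finally show ?case using assms(4)[of n] by linarith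
  qed
  then show ?thesis unfolding expdecay_def using D s by blast
qed

subsection \<open>Spectral splitting\<close>

text \<open>Commutation with \<open>V\<close> is built in so that splitting the identity produces
  parts that commute with \<open>V\<close>.\<close>

definition decaying :: "complex^'n^'n \<Rightarrow> (complex^'n^'n) set" where
  "decaying V = {Y. V ** Y = Y ** V \<and> expdecay (\<lambda>n. lpow V n Y)}"

text \<open>Supplies the finite-dimensional real space on which injectivity is turned into
  surjectivity in \<open>splittable_factor_inside\<close>.\<close>

lemma subspace_decaying: "subspace (decaying V)" for V :: "complex^'n^'n"
proof (rule subspaceI)
  have "lpow V n (0::complex^'n^'n) = 0" for n by (induction n) auto
  then show "0 \<in> decaying V" by (simp add: decaying_def expdecay_0)
next
  fix x y assume "x \<in> decaying V" "y \<in> decaying V"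
  then show "x + y \<in> decaying V"
    by (simp add: decaying_def lpow_add expdecay_add matrix_add_ldistrib matrix_add_rdistrib)
next
  fix c :: real and x assume "x \<in> decaying V"
  then show "c *\<^sub>R x \<in> decaying V"
    by (simp add: decaying_def lpow_scaleR
        expdecay_bounded_linear[OF bounded_linear_scaleR_right]
        bounded_bilinear.scaleR_right[OF bounded_bilinear_matrix_mult]
        bounded_bilinear.scaleR_left[OF bounded_bilinear_matrix_mult])
qed

lemma decaying_mult_left:
  assumes "V ** N = N ** V" "Y \<in> decaying V"
  shows "N ** Y \<in> decaying V"
  using assms unfolding decaying_def
  by (auto simp: lpow_commute intro!: expdecay_bounded_linear[OF bounded_linear_matrix_mult_right])
     (metis matrix_mul_assoc)

lemma commute_inverse:
  assumes "V ** W = mat 1" "W ** V = mat 1"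
  shows "V ** Y = Y ** V \<longleftrightarrow> W ** Y = Y ** W"
  by (metis assms matrix_mul_assoc matrix_mul_lid matrix_mul_rid)

text \<open>Meant for \<open>W\<close> the inverse of \<open>V\<close>: then \<open>P\<close> decays
  forward and \<open>Q\<close> decays backward. Naming the inverse keeps the notion symmetric, so
  the two time directions can be exchanged.\<close>

definition splittable :: "complex^'n^'n \<Rightarrow> complex^'n^'n \<Rightarrow> (complex^'n^'n) set" where
  "splittable V W = {P + Q |P Q. P \<in> decaying V \<and> Q \<in> decaying W}"

lemma splittable_swap: "splittable V W = splittable W V"
  unfolding splittable_def using add.commute by blast

lemma splittableI: "P \<in> decaying V \<Longrightarrow> Q \<in> decaying W \<Longrightarrow> P + Q \<in> splittable V W"
  unfolding splittable_def by blast

lemma splittable_mult_left: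
  assumes "V ** N = N ** V" "W ** N = N ** W" "Y \<in> splittable V W"
  shows "N ** Y \<in> splittable V W"
  using assms unfolding splittable_def by (auto simp: matrix_add_ldistrib) (metis decaying_mult_left)

text \<open>On the finite-dimensional space of backward decaying matrices, multiplication by
  \<open>V - z\<close> is injective for \<open>|z| < 1\<close>, hence onto; this removes the backward decaying part of
  the right-hand side, and what remains is a contracting recurrence.\<close>

lemma splittable_factor_inside:
  fixes V W Y :: "complex^'n^'n"
  assumes VW: "V ** W = mat 1" "W ** V = mat 1"
    and comm: "V ** Y = Y ** V" and z: "cmod z < 1"
    and split: "(V - mat z) ** Y \<in> splittable V W"
  shows "Y \<in> splittable V W"
proof -
  define B where "B = V - mat z"
  have BV: "V ** B = B ** V"
    by (simp add: B_def matrix_diff_ldistrib matrix_diff_rdistrib mat_commute)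
  then have BW: "W ** B = B ** W" using commute_inverse[OF VW] by metis
  obtain P Q where PQ: "P \<in> decaying V" "Q \<in> decaying W" "B ** Y = P + Q"
    using split unfolding splittable_def B_def by blast
  let ?U = "decaying W"
  have lin: "linear (\<lambda>M. B ** M)"
    using bounded_linear_matrix_mult_right bounded_linear.linear by blast
  \<comment> \<open>A kernel element satisfies \<open>V M = z M\<close>, hence
    \<open>M = z W M\<close>. Since |z| < 1, the norms of \<open>W^n M\<close> cannot drop below
    that of \<open>M\<close>, yet they tend to 0.\<close>
  have zero: "M = 0" if M: "M \<in> ?U" "B ** M = 0" for M
  proof -
    have "V ** M = mat z ** M" using M(2) by (simp add: B_def matrix_diff_rdistrib)
    then have "M = W ** (mat z ** M)" by (metis VW(2) matrix_mul_assoc matrix_mul_lid)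
    then have M': "M = mat z ** (W ** M)" by (simp add: mat_left_commute)
    have *: "norm M \<le> norm (lpow W n M)" for n
    proof (induction n)
      case (Suc n)
      have "lpow W n M = mat z ** lpow W (Suc n) M"
        using M' lpow_commute[where V=W and N="mat z" and n=n and Y="W ** M", OF mat_commute[symmetric]] unfolding lpow_Suc2 by simp
      then have "norm (lpow W n M) \<le> norm (lpow W (Suc n) M)"
        using z by (simp add: norm_mat_mult mult_left_le_one_le del: lpow.simps)
      with Suc show ?case by linarith
    qed simp
    have "(\<lambda>n. norm (lpow W n M)) \<longlonglongrightarrow> 0"
      using M(1) expdecay_tendsto_0 tendsto_norm_zero by (auto simp: decaying_def)
    then have "norm M \<le> 0" using * by (intro LIMSEQ_le_const) auto
    then show ?thesis by simp
  qed
  have sub: "subspace ?U" by (rule subspace_decaying)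
  have "inj_on (\<lambda>M. B ** M) ?U"
    using zero linear_inj_on_iff_eq_0[OF lin sub] by blast
  moreover have sp: "span ?U = ?U" using sub by (simp add: span_eq_iff)
  ultimately have "dim ((\<lambda>M. B ** M) ` ?U) = dim ?U" by (metis dim_image_eq lin)
  moreover have "(\<lambda>M. B ** M) ` ?U \<subseteq> ?U" using decaying_mult_left[OF BW] by blast
  moreover have "subspace ((\<lambda>M. B ** M) ` ?U)" using lin sub by (rule linear_subspace_image)
  ultimately have "(\<lambda>M. B ** M) ` ?U = ?U" using sub by (intro subspace_dim_equal) auto
  then obtain R where R: "R \<in> ?U" "Q = B ** R" using PQ(2) by (metis imageE)
  define S where "S = Y - R"
  have BS: "B ** S = P" using PQ(3) R by (simp add: S_def matrix_diff_ldistrib)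
  then have VS: "V ** S = mat z ** S + P" by (simp add: B_def matrix_diff_rdistrib algebra_simps)
  have "V ** R = R ** V" using R(1) commute_inverse[OF VW] by (auto simp: decaying_def)
  then have cS: "V ** S = S ** V"
    using comm by (simp add: S_def matrix_diff_ldistrib matrix_diff_rdistrib)
  have "expdecay (\<lambda>n. lpow V n S)"
  proof (rule expdecay_recurrence)
    show "expdecay (\<lambda>n. lpow V n P)" using PQ by (simp add: decaying_def)
    show "norm (lpow V (Suc n) S) \<le> cmod z * norm (lpow V n S) + norm (lpow V n P)" for n
      unfolding lpow_Suc2 VS lpow_add lpow_commute[OF mat_commute[symmetric]]
      using norm_triangle_ineq[of "mat z ** lpow V n S" "lpow V n P"] by (simp add: norm_mat_mult)
  qed (use z in auto)
  then have "S \<in> decaying V" using cS by (simp add: decaying_def)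
  then show ?thesis using splittableI[OF _ R(1), of S V] by (simp add: S_def)
qed

text \<open>An invertible factor is cancelled by its inverse, which commutes with \<open>V\<close>
  and \<open>W\<close>. A root inside the circle is the preceding lemma, and one outside becomes a
  root inside after exchanging \<open>V\<close> with \<open>W\<close> and \<open>z\<close> with
  \<open>1/z\<close>. A singular factor with |z| = 1 would give an eigenvector that
  \<open>hyp\<close> excludes.\<close>

lemma splittable_factor:
  fixes V W Y :: "complex^'n^'n"
  assumes VW: "V ** W = mat 1" "W ** V = mat 1"
    and hyp: "\<And>z v. v \<noteq> 0 \<Longrightarrow> V *v v = z *s v \<Longrightarrow> cmod z \<noteq> 1"
    and comm: "V ** Y = Y ** V"
    and split: "(V - mat z) ** Y \<in> splittable V W"
  shows "Y \<in> splittable V W"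
proof -
  define B where "B = V - mat z"
  have BV: "V ** B = B ** V"
    by (simp add: B_def matrix_diff_ldistrib matrix_diff_rdistrib mat_commute)
  consider "invertible B" | "cmod z < 1" | "\<not> invertible B" "cmod z > 1" | "\<not> invertible B" "cmod z = 1"
    by linarith
  then show ?thesis
  proof cases
    case 1
    let ?N = "matrix_inv B"
    note N = matrix_inv[OF 1]
    have NV: "V ** ?N = ?N ** V" using commute_inverse[OF N, of V] BV by metis
    then have NW: "W ** ?N = ?N ** W" using commute_inverse[OF VW] by metis
    have "Y = ?N ** (B ** Y)" by (simp add: matrix_mul_assoc N)
    then show ?thesis using splittable_mult_left[OF NV NW split] by (simp add: B_def)
  next
    case 2
    then show ?thesis using splittable_factor_inside[OF VW comm _ split] by blast
  next
    case 3
    then have z: "z \<noteq> 0" "cmod (1/z) < 1" by (auto simp: norm_divide divide_simps)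
    \<comment> \<open>The identity \<open>W - 1/z = -(1/z) W (V - z)\<close> transfers the
      hypothesis to the reversed direction.\<close>
    have "(W - mat (1/z)) ** Y = (mat (-1/z) ** W) ** ((V - mat z) ** Y)"
    proof -
      have "(mat (-1/z) ** W) ** ((V - mat z) ** Y) = mat (-1/z) ** ((W ** V) ** Y - W ** (mat z ** Y))"
        by (simp add: matrix_diff_rdistrib matrix_diff_ldistrib matrix_mul_assoc)
      also have "\<dots> = mat (-1/z) ** Y - (mat (-1/z) ** mat z) ** (W ** Y)"
        unfolding VW mat_left_commute[of W z] matrix_diff_ldistrib by (simp add: matrix_mul_assoc)
      also have "\<dots> = (W - mat (1/z)) ** Y"
        using z by (simp add: vec_eq_iff mat_mult_mat mat_matrix_mult_nth matrix_diff_rdistrib)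
      finally show ?thesis by simp
    qed
    moreover have "(mat (-1/z) ** W) ** ((V - mat z) ** Y) \<in> splittable V W"
    proof (rule splittable_mult_left[OF _ _ split])
      show "V ** (mat (-1/z) ** W) = (mat (-1/z) ** W) ** V"
        by (metis VW mat_left_commute matrix_mul_assoc)
      show "W ** (mat (-1/z) ** W) = (mat (-1/z) ** W) ** W"
        by (metis mat_left_commute matrix_mul_assoc)
    qed
    ultimately have "(W - mat (1/z)) ** Y \<in> splittable W V" by (simp add: splittable_swap)
    then have "Y \<in> splittable W V"
      using splittable_factor_inside[OF VW(2,1) _ z(2)] comm commute_inverse[OF VW] by blast
    then show ?thesis by (simp add: splittable_swap)
  next
    case 4
    then have "\<not> (\<exists>M. M ** B = mat 1)" using invertible_left_inverse by blast
    then obtain v where v: "v \<noteq> 0" "B *v v = 0" unfolding matrix_left_invertible_ker by blast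
    then have "V *v v = z *s v" by (simp add: B_def matrix_vector_mult_diff_rdistrib mat_mult_vec)
    with hyp[OF v(1)] 4 show ?thesis by blast
  qed
qed

text \<open>Induction on the degree: if \<open>p = (x - z) q\<close> and \<open>p(V) Y = 0\<close>,
  then \<open>Z = (V - z) Y\<close> is annihilated by \<open>q(V)\<close>, so \<open>Z\<close>
  splits and \<open>splittable_factor\<close> returns to \<open>Y\<close>. The matrix changes at
  each step, hence the generalisation over \<open>Y\<close>.\<close>

lemma splittable_annihilated:
  fixes V W Y :: "complex^'n^'n"
  assumes VW: "V ** W = mat 1" "W ** V = mat 1"
    and hyp: "\<And>z v. v \<noteq> 0 \<Longrightarrow> V *v v = z *s v \<Longrightarrow> cmod z \<noteq> 1"
    and "V ** Y = Y ** V" "p \<noteq> 0"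
    and "(\<Sum>i\<le>degree p. mat (coeff p i) ** lpow V i Y) = 0"
  shows "Y \<in> splittable V W"
  using assms(4-)
proof (induction "degree p" arbitrary: p Y)
  case 0
  then have "mat (coeff p 0) ** Y = 0" "coeff p 0 \<noteq> 0"
    using leading_coeff_neq_0[of p] by auto
  then have "mat (1 / coeff p 0 * coeff p 0) ** Y = 0" "coeff p 0 \<noteq> 0"
    unfolding mat_mult_mat[symmetric] by (auto simp: matrix_mul_assoc[symmetric])
  then have "Y = 0" by simp
  moreover have "0 + 0 \<in> splittable V W"
    using splittableI subspace_0 subspace_decaying by blast
  ultimately show ?case by simp
next
  case (Suc d)
  then have "\<not> constant (poly p)" by (metis constant_degree nat.distinct(1))
  then obtain z where "poly p z = 0" using fundamental_theorem_of_algebra by blast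
  then obtain q where q: "p = [:- z, 1:] * q" by (metis dvdE poly_eq_0_iff_dvd)
  then have q0: "q \<noteq> 0" using Suc.prems by auto
  then have "degree p = Suc (degree q)" unfolding q by (subst degree_mult_eq) auto
  then have dq: "d = degree q" "degree p = Suc (degree q)" using Suc by auto
  define Z where "Z = (V - mat z) ** Y"
  have Zlp: "lpow V i Z = lpow V (Suc i) Y - mat z ** lpow V i Y" for i
    unfolding Z_def matrix_diff_rdistrib lpow_diff lpow_Suc2
    by (simp add: lpow_commute[OF mat_commute[symmetric]])
  have cp: "coeff p i = coeff (pCons 0 q) i - z * coeff q i" for i
    by (simp add: q)
  have md: "mat (a - b) ** M = mat a ** M - mat b ** M" for a b and M :: "complex^'n^'n"
    by (simp add: vec_eq_iff mat_matrix_mult_nth algebra_simps)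
  \<comment> \<open>Here \<open>pCons 0 q\<close> is \<open>x q\<close>. Both sums run to
    \<open>Suc d\<close>: the first loses its vanishing constant coefficient by an index shift, the
    second its top term because \<open>q\<close> has degree \<open>d\<close>.\<close>
  have "0 = (\<Sum>i\<le>Suc d. mat (coeff (pCons 0 q) i) ** lpow V i Y)
      - (\<Sum>i\<le>Suc d. mat (z * coeff q i) ** lpow V i Y)"
    using Suc.prems(3) unfolding Suc.hyps(2)[symmetric] cp md sum_subtractf by simp
  also have "(\<Sum>i\<le>Suc d. mat (coeff (pCons 0 q) i) ** lpow V i Y)
      = (\<Sum>i\<le>d. mat (coeff q i) ** lpow V (Suc i) Y)"
    by (subst sum.atMost_Suc_shift) simp
  also have "(\<Sum>i\<le>Suc d. mat (z * coeff q i) ** lpow V i Y)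
      = (\<Sum>i\<le>d. mat (coeff q i) ** (mat z ** lpow V i Y))"
    by (simp add: coeff_eq_0 dq matrix_mul_assoc mat_mult_mat mult.commute)
  finally have "(\<Sum>i\<le>d. mat (coeff q i) ** lpow V i Z) = 0"
    by (simp add: Zlp matrix_diff_ldistrib sum_subtractf)
  moreover have "V ** Z = Z ** V"
  proof -
    have "V ** (V - mat z) = (V - mat z) ** V"
      by (simp add: matrix_diff_ldistrib matrix_diff_rdistrib mat_commute)
    then show ?thesis using Suc.prems(1) unfolding Z_def by (metis matrix_mul_assoc)
  qed
  ultimately have "Z \<in> splittable V W" using Suc.hyps(1)[OF dq(1) _ q0] dq by blast
  then show ?case using splittable_factor[OF VW hyp Suc.prems(1)] by (simp add: Z_def)
qed

text \<open>One more iterate than the real dimension of the matrix space forces a linear relation,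
  and its coefficients form the polynomial.\<close>

lemma annihilating_poly_exists:
  fixes V Y :: "complex^'n^'n"
  obtains p where "p \<noteq> 0" "(\<Sum>i\<le>degree p. mat (coeff p i) ** lpow V i Y) = 0"
proof -
  let ?N = "DIM(complex^'n^'n)"
  let ?f = "\<lambda>i. lpow V i Y"
  have "\<exists>c::nat \<Rightarrow> real. (\<exists>i\<le>?N. c i \<noteq> 0) \<and> (\<Sum>i\<le>?N. c i *\<^sub>R ?f i) = 0"
  \<comment> \<open>Linear dependence is a property of the set of iterates, which is large enough
    only when they are distinct. Two equal iterates give the relation directly, with coefficients 1
    and -1.\<close>
  proof (cases "inj_on ?f {..?N}")
    case True
    have "dependent (?f ` {..?N})"
      by (rule dependent_biggerset) (subst card_image[OF True], simp)
    then obtain u where "\<exists>v\<in>?f ` {..?N}. u v \<noteq> 0" "(\<Sum>v\<in>?f ` {..?N}. u v *\<^sub>R v) = 0"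
      by (auto simp: real_vector.dependent_finite)
    then show ?thesis
      by (intro exI[of _ "u \<circ> ?f"]) (auto simp: sum.reindex[OF True] simp del: DIM_cart)
  next
    case False
    then obtain i j where ij: "i \<le> ?N" "j \<le> ?N" "i \<noteq> j" "?f i = ?f j"
      unfolding inj_on_def by auto
    define c where "c k = (if k = i then 1 else 0) - (if k = j then 1 else (0::real))" for k
    have "(\<Sum>k\<le>?N. c k *\<^sub>R ?f k) =
        (\<Sum>k\<le>?N. if k = i then ?f k else 0) - (\<Sum>k\<le>?N. if k = j then ?f k else 0)"
      unfolding sum_subtractf[symmetric] by (rule sum.cong) (auto simp: c_def)
    also have "\<dots> = 0" using ij by (simp add: sum.delta)
    finally show ?thesis using ij by (intro exI[of _ c]) (auto simp: c_def)
  qed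
  then obtain c where c: "\<exists>i\<le>?N. c i \<noteq> 0" "(\<Sum>i\<le>?N. c i *\<^sub>R ?f i) = 0" by blast
  define p where "p = (\<Sum>i\<le>?N. monom (complex_of_real (c i)) i)"
  have cp: "coeff p i = (if i \<le> ?N then of_real (c i) else 0)" for i
    by (auto simp: p_def coeff_sum)
  have "p \<noteq> 0" using c(1) cp by (metis coeff_0 of_real_eq_0_iff)
  moreover have "(\<Sum>i\<le>degree p. mat (coeff p i) ** ?f i) = (\<Sum>i\<le>?N. mat (coeff p i) ** ?f i)"
    by (rule sum.mono_neutral_left) (auto simp: cp intro: degree_le le_degree)
  ultimately show thesis using c(2) by (intro that[of p]) (auto simp: cp mat_of_real_mult)
qed

lemma complex_spectral_splitting:
  fixes V W :: "complex^'n^'n"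
  assumes VW: "V ** W = mat 1" "W ** V = mat 1"
    and hyp: "\<And>z v. v \<noteq> 0 \<Longrightarrow> V *v v = z *s v \<Longrightarrow> cmod z \<noteq> 1"
  obtains P Q where "P + Q = mat 1" "V ** P = P ** V" "W ** Q = Q ** W"
    "expdecay (\<lambda>n. lpow V n P)" "expdecay (\<lambda>n. lpow W n Q)"
proof -
  obtain p where "p \<noteq> 0" "(\<Sum>i\<le>degree p. mat (coeff p i) ** lpow V i (mat 1)) = 0"
    by (rule annihilating_poly_exists)
  then have "mat 1 \<in> splittable V W" by (intro splittable_annihilated[OF VW hyp]) auto
  then show thesis using that unfolding splittable_def decaying_def by auto
qed

subsection \<open>Complexification\<close>

abbreviation cmat :: "real^'k^'n \<Rightarrow> complex^'k^'n" where
  "cmat \<equiv> map_matrix complex_of_real"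

lemma cmat_mult: "cmat (A ** B) = cmat A ** cmat B"
  by (simp add: vec_eq_iff map_matrix_def matrix_matrix_mult_def)

lemma cmat_mat: "cmat (mat c) = mat (of_real c)"
  by (simp add: vec_eq_iff map_matrix_def mat_def)

lemma cmat_diff: "cmat (A - B) = cmat A - cmat B"
  by (simp add: vec_eq_iff map_matrix_def)

lemma cmat_lpow: "cmat (lpow V n Y) = lpow (cmat V) n (cmat Y)"
  by (induction n) (auto simp: cmat_mult)

lemma bounded_linear_map_matrix:
  fixes f :: "'a::euclidean_space \<Rightarrow> 'b::euclidean_space"
  assumes "linear f"
  shows "bounded_linear (map_matrix f :: 'a^'k^'n \<Rightarrow> 'b^'k^'n)"
  unfolding linear_conv_bounded_linear[symmetric]
  by (rule linearI) (simp_all add: vec_eq_iff map_matrix_def linear_add[OF assms] linear_scale[OF assms])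

lemma bounded_linear_cmat: "bounded_linear (cmat :: real^'k^'n \<Rightarrow> complex^'k^'n)"
  by (rule bounded_linear_map_matrix) (simp add: bounded_linear.linear bounded_linear_of_real)

lemma bounded_linear_map_matrix_Re: "bounded_linear (map_matrix Re :: complex^'k^'n \<Rightarrow> real^'k^'n)"
  by (rule bounded_linear_map_matrix) (simp add: bounded_linear.linear bounded_linear_Re)

lemma map_matrix_Re_cmat_mult:
  shows "map_matrix Re (cmat A ** M) = A ** map_matrix Re M"
    and "map_matrix Re (N ** cmat A) = map_matrix Re N ** A"
  by (simp_all add: vec_eq_iff map_matrix_def matrix_matrix_mult_def)

lemma map_matrix_Re_lpow: "map_matrix Re (lpow (cmat V) n Y) = lpow V n (map_matrix Re Y)"
  by (induction n) (auto simp: map_matrix_Re_cmat_mult)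

text \<open>Entrywise real parts of the complex splitting keep decay and commutation because
  \<open>V\<close> is real. Idempotence comes from the decay: \<open>P Q = (V^n P) (V^-n Q)\<close>
  for every \<open>n\<close>, and the right side tends to 0, so \<open>P Q = 0\<close> with
  \<open>Q = 1 - P\<close>.\<close>

lemma real_spectral_projection:
  fixes V :: "real^'n^'n"
  assumes inv: "invertible V" and hyp: "\<And>z. complex_eigenvalue V z \<Longrightarrow> cmod z \<noteq> 1"
  obtains P where "P ** P = P" "V ** P = P ** V" "expdecay (\<lambda>n. lpow V n P)"
    "expdecay (\<lambda>n. lpow (matrix_inv V) n (mat 1 - P))"
proof -
  let ?W = "matrix_inv V"
  note VW = matrix_inv[OF inv]
  have "cmat V ** cmat ?W = mat 1" "cmat ?W ** cmat V = mat 1"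
    unfolding cmat_mult[symmetric] VW cmat_mat by simp_all
  moreover have "cmod z \<noteq> 1" if "v \<noteq> 0" "cmat V *v v = z *s v" for z v
    using hyp that unfolding complex_eigenvalue_def by blast
  ultimately obtain P' Q' where PQ': "P' + Q' = mat 1" "cmat V ** P' = P' ** cmat V"
    "cmat ?W ** Q' = Q' ** cmat ?W"
    "expdecay (\<lambda>n. lpow (cmat V) n P')" "expdecay (\<lambda>n. lpow (cmat ?W) n Q')"
    by (rule complex_spectral_splitting)
  define P where "P = map_matrix Re P'"
  define Q where "Q = map_matrix Re Q'"
  have "map_matrix Re (P' + Q') = map_matrix Re (mat 1)" using PQ' by simp
  then have PQ: "P + Q = mat 1"
    by (simp add: P_def Q_def vec_eq_iff map_matrix_def) (simp add: mat_def if_distrib)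
  have VP: "V ** P = P ** V"
    unfolding P_def map_matrix_Re_cmat_mult[symmetric] PQ' ..
  have decP: "expdecay (\<lambda>n. lpow V n P)"
    using expdecay_bounded_linear[OF bounded_linear_map_matrix_Re PQ'(4)]
    by (simp add: map_matrix_Re_lpow P_def)
  have decQ: "expdecay (\<lambda>n. lpow ?W n Q)"
    using expdecay_bounded_linear[OF bounded_linear_map_matrix_Re PQ'(5)]
    by (simp add: map_matrix_Re_lpow Q_def)
  have "lpow V n P ** lpow ?W n Q = P ** Q" for n
  proof (induction n)
    case (Suc n)
    have "V ** lpow V n P = lpow V n P ** V"
      by (metis VP lpow.simps(2) lpow_Suc2 lpow_mult_right)
    then have "lpow V (Suc n) P ** lpow ?W (Suc n) Q = lpow V n P ** (V ** ?W) ** lpow ?W n Q"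
      by (simp add: matrix_mul_assoc)
    then show ?case using Suc VW by simp
  qed simp
  then have "(\<lambda>n. P ** Q) \<longlonglongrightarrow> 0 ** 0"
    using bounded_bilinear.tendsto[OF bounded_bilinear_matrix_mult
        expdecay_tendsto_0[OF decP] expdecay_tendsto_0[OF decQ]] by simp
  then have "P ** Q = 0" by (simp add: LIMSEQ_const_iff)
  moreover have Q: "Q = mat 1 - P" using PQ by (simp add: algebra_simps)
  ultimately have "P ** P = P" by (simp add: matrix_diff_ldistrib)
  then show thesis using that VP decP decQ Q by blast
qed

subsection \<open>Inversion and uniqueness of the transition matrix\<close>

lemma tendsto_det:
  fixes X :: "'b \<Rightarrow> real^'n^'n"
  assumes "(X \<longlongrightarrow> M) F"
  shows "((\<lambda>t. det (X t)) \<longlongrightarrow> det M) F"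
  unfolding det_def by (intro tendsto_intros assms)

text \<open>Cramer's rule for the \<open>l\<close>-th column of the inverse; it exhibits the entries
  as quotients of determinants, from which continuity follows.\<close>

lemma matrix_inv_nth:
  fixes M :: "real^'n^'n"
  assumes "invertible M"
  shows "matrix_inv M $ k $ l =
    det (\<chi> i j. if j = k then axis l 1 $ i else M $ i $ j) / det M"
proof -
  have "M *v (matrix_inv M *v axis l 1) = axis l 1"
    by (simp add: matrix_vector_mul_assoc matrix_inv[OF assms])
  then have "matrix_inv M *v axis l 1 =
      (\<chi> k. det (\<chi> i j. if j = k then axis l 1 $ i else M $ i $ j) / det M)"
    using cramer[of M] assms by (simp add: invertible_det_nz)
  then have "(matrix_inv M *v axis l 1) $ k =
      det (\<chi> i j. if j = k then axis l 1 $ i else M $ i $ j) / det M" by simp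
  then show ?thesis by (simp add: matrix_vector_mult_basis column_def)
qed

text \<open>The determinant stays nonzero near the limit, so Cramer's formula holds eventually and
  converges entry by entry.\<close>

lemma tendsto_matrix_inv:
  fixes X :: "'b \<Rightarrow> real^'n^'n"
  assumes X: "(X \<longlongrightarrow> M) F" and M: "invertible M"
  shows "((\<lambda>t. matrix_inv (X t)) \<longlongrightarrow> matrix_inv M) F"
proof (intro vec_tendstoI)
  fix k l :: 'n
  have M': "det M \<noteq> 0" using M by (simp add: invertible_det_nz)
  have "((\<lambda>t. det (\<chi> i j. if j = k then axis l 1 $ i else X t $ i $ j) / det (X t)) \<longlongrightarrow>
      det (\<chi> i j. if j = k then axis l 1 $ i else M $ i $ j) / det M) F"
  proof (intro tendsto_divide tendsto_det X M' vec_tendstoI)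
    fix i j
    have "((\<lambda>t. X t $ i $ j) \<longlongrightarrow> M $ i $ j) F" by (intro tendsto_intros X)
    then show "((\<lambda>t. (\<chi> i j. if j = k then axis l 1 $ i else X t $ i $ j) $ i $ j) \<longlongrightarrow>
      (\<chi> i j. if j = k then axis l 1 $ i else M $ i $ j) $ i $ j) F" by auto
  qed
  moreover have "\<forall>\<^sub>F t in F. det (X t) \<noteq> 0"
    using tendsto_imp_eventually_ne[OF tendsto_det[OF X] M'] .
  then have "\<forall>\<^sub>F t in F. det (\<chi> i j. if j = k then axis l 1 $ i else X t $ i $ j) / det (X t)
      = matrix_inv (X t) $ k $ l"
    by eventually_elim (simp add: matrix_inv_nth invertible_det_nz)
  ultimately show "((\<lambda>t. matrix_inv (X t) $ k $ l) \<longlongrightarrow> matrix_inv M $ k $ l) F"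
    unfolding matrix_inv_nth[OF M] by (rule Lim_transform_eventually)
qed

text \<open>The difference quotient of \<open>X\<inverse>Y\<close> at \<open>x\<close> is \<open>X(y)\<inverse>\<close> times that of \<open>Y - XC\<close> with
  \<open>C = X(x)\<inverse>Y(x)\<close>, a function whose derivative at \<open>x\<close> vanishes; so continuity of inversion
  suffices.\<close>

lemma fundamental_matrix_unique:
  assumes J: "open J" "convex J"
    and X: "fundamental_matrix J A X" and Y: "fundamental_matrix J A Y"
    and t: "t \<in> J" and s: "s \<in> J"
  shows "X t ** matrix_inv (X s) = Y t ** matrix_inv (Y s)"
proof -
  define W where "W = (\<lambda>t. matrix_inv (X t) ** Y t)"
  have XW: "X x ** W x = Y x" if "x \<in> J" for x
    using X that by (simp add: W_def matrix_mul_assoc matrix_inv fundamental_matrix_def)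
  have "(W has_vector_derivative 0) (at x within J)" if x: "x \<in> J" for x
  proof -
    define f where "f = (\<lambda>y. Y y - X y ** W x)"
    have dX: "(X has_vector_derivative A x ** X x) (at x)" and
      dY: "(Y has_vector_derivative A x ** Y x) (at x)" and iX: "invertible (X x)"
      using X Y x by (auto simp: fundamental_matrix_def)
    have fx: "f x = 0" using XW[OF x] by (simp add: f_def)
    have "(f has_vector_derivative A x ** Y x - A x ** X x ** W x) (at x)"
      unfolding f_def
      by (intro has_vector_derivative_diff dY
          bounded_linear.has_vector_derivative[OF bounded_linear_matrix_mult_left dX])
    then have "(f has_vector_derivative 0) (at x)"
      using XW[OF x] by (simp add: matrix_mul_assoc[symmetric])
    then have f0: "((\<lambda>y. (1 / norm (y - x)) *\<^sub>R f y) \<longlongrightarrow> 0) (at x within J)"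
      using fx has_vector_derivative_at_within[of f 0 x J]
      by (simp add: has_vector_derivative_def has_derivative_within)
    have "(X \<longlongrightarrow> X x) (at x within J)"
      using has_vector_derivative_continuous[OF dX] continuous_within_subset
      by (metis continuous_within subset_UNIV)
    then have "((\<lambda>y. matrix_inv (X y)) \<longlongrightarrow> matrix_inv (X x)) (at x within J)"
      using iX by (rule tendsto_matrix_inv)
    from bounded_bilinear.tendsto[OF bounded_bilinear_matrix_mult this f0]
    have "((\<lambda>y. matrix_inv (X y) ** ((1 / norm (y - x)) *\<^sub>R f y)) \<longlongrightarrow> 0) (at x within J)"
      by simp
    moreover have "\<forall>\<^sub>F y in at x within J.
        matrix_inv (X y) ** ((1 / norm (y - x)) *\<^sub>R f y) = (1 / norm (y - x)) *\<^sub>R (W y - W x)"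
    proof -
      have "matrix_inv (X y) ** f y = W y - W x" if "y \<in> J" for y
        using X that
        by (simp add: f_def matrix_diff_ldistrib matrix_mul_assoc matrix_inv fundamental_matrix_def)
           (simp add: W_def)
      then show ?thesis
        by (auto simp: eventually_at_filter bounded_bilinear.scaleR_right[OF bounded_bilinear_matrix_mult])
    qed
    ultimately have "((\<lambda>y. (1 / norm (y - x)) *\<^sub>R (W y - W x)) \<longlongrightarrow> 0) (at x within J)"
      by (rule Lim_transform_eventually)
    then show ?thesis by (simp add: has_vector_derivative_def has_derivative_within)
  qed
  \<comment> \<open>A zero derivative on a convex set makes \<open>W\<close> a constant
    \<open>C\<close>. Thus \<open>Y = X C\<close> on \<open>J\<close>, and \<open>C\<close> cancels
    from the transition matrix.\<close>
  then obtain C where "\<And>x. x \<in> J \<Longrightarrow> W x = C"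
    using has_vector_derivative_zero_constant[OF J(2), of W] by blast
  then have Yx: "Y x = X x ** C" if "x \<in> J" for x using XW that by metis
  have "X s ** (C ** matrix_inv (Y s)) = mat 1"
    unfolding matrix_mul_assoc Yx[OF s, symmetric]
    using Y s by (simp add: matrix_inv fundamental_matrix_def)
  then have "matrix_inv (X s) = C ** matrix_inv (Y s)" by (rule matrix_inv_unique)
  then show ?thesis using Yx[OF t] by (simp add: matrix_mul_assoc)
qed

text \<open>Uniqueness makes the definite description well defined, so any fundamental matrix
  computes it.\<close>

lemma transition_matrix_eq:
  assumes "open J" "convex J" "fundamental_matrix J A X" "t \<in> J" "s \<in> J"
  shows "transition_matrix J A t s = X t ** matrix_inv (X s)"
  unfolding transition_matrix_def
proof (rule the_equality)
  show "\<exists>Y. fundamental_matrix J A Y \<and> X t ** matrix_inv (X s) = Y t ** matrix_inv (Y s)"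
    using assms(3) by blast
qed (use fundamental_matrix_unique[OF assms(1,2) _ assms(3-5)] in blast)

subsection \<open>Norms on a Euclidean space\<close>

lemma is_norm_le_norm:
  fixes nrm :: "real^'n \<Rightarrow> real"
  assumes N: "is_norm nrm"
  obtains b where "b > 0" "\<And>x. nrm x \<le> b * norm x"
proof -
  \<comment> \<open>Expanding in the standard basis gives the sum as a bound; the added 1 makes
    \<open>b\<close> positive outright.\<close>
  define b where "b = (\<Sum>i\<in>UNIV. nrm (axis i 1)) + 1"
  have sum: "nrm (sum f S) \<le> (\<Sum>i\<in>S. nrm (f i))" if "finite S" for S :: "'n set" and f
    using that
  proof induction
    case empty
    have "nrm 0 = 0" using N unfolding is_norm_def by blast
    then show ?case by simp
  next
    case (insert x S)
    have "nrm (f x + sum f S) \<le> nrm (f x) + nrm (sum f S)" using N unfolding is_norm_def by blast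
    then show ?case using insert by simp
  qed
  have "nrm x \<le> b * norm x" for x
  proof -
    have "nrm x = nrm (\<Sum>i\<in>UNIV. x $ i *\<^sub>R axis i 1)"
      using basis_expansion[of x] by (simp add: scalar_mult_eq_scaleR)
    also have "\<dots> \<le> (\<Sum>i\<in>UNIV. nrm (x $ i *\<^sub>R axis i 1))" by (rule sum) simp
    also have "\<dots> = (\<Sum>i\<in>UNIV. \<bar>x $ i\<bar> * nrm (axis i 1))" using N by (simp add: is_norm_def)
    also have "\<dots> \<le> (\<Sum>i\<in>UNIV. norm x * nrm (axis i 1))"
      using N by (intro sum_mono mult_right_mono component_le_norm_cart) (auto simp: is_norm_def)
    also have "\<dots> \<le> b * norm x" by (simp add: b_def sum_distrib_left algebra_simps)
    finally show ?thesis .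
  qed
  moreover have "b > 0" using N by (auto simp: b_def is_norm_def intro!: add_nonneg_pos sum_nonneg)
  ultimately show thesis using that by blast
qed

text \<open>Equivalence of norms by compactness: \<open>nrm\<close> is Lipschitz for the Euclidean
  norm, so it attains a minimum on the unit sphere, which is positive by definiteness.\<close>

lemma norm_le_is_norm:
  fixes nrm :: "real^'n \<Rightarrow> real"
  assumes N: "is_norm nrm"
  obtains c where "c > 0" "\<And>x. norm x \<le> c * nrm x"
proof -
  obtain b where b: "b > 0" "\<And>x. nrm x \<le> b * norm x" using is_norm_le_norm[OF N] by blast
  have minus: "nrm (- x) = nrm x" for x
  proof -
    have "nrm ((-1) *\<^sub>R x) = \<bar>-1\<bar> * nrm x" using N unfolding is_norm_def by blast
    then show ?thesis by simp
  qed
  have tri: "nrm x - nrm y \<le> nrm (x - y)" for x y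
  proof -
    have "nrm ((x - y) + y) \<le> nrm (x - y) + nrm y" using N unfolding is_norm_def by blast
    then show ?thesis by simp
  qed
  have "b-lipschitz_on UNIV nrm"
  proof (rule lipschitz_onI)
    fix x y
    have "\<bar>nrm x - nrm y\<bar> \<le> nrm (x - y)" using tri[of x y] tri[of y x] minus[of "x - y"] by auto
    then show "dist (nrm x) (nrm y) \<le> b * dist x y"
      using b(2)[of "x - y"] by (simp add: dist_real_def dist_norm)
  qed (use b in auto)
  then have "continuous_on (sphere 0 1) nrm"
    using lipschitz_on_continuous_on continuous_on_subset by blast
  moreover have "axis undefined 1 \<in> sphere (0::real^'n) 1" by (simp add: norm_eq_sqrt_inner inner_axis_axis)
  ultimately obtain x0 where x0: "x0 \<in> sphere 0 1" "\<And>x. x \<in> sphere 0 1 \<Longrightarrow> nrm x0 \<le> nrm x"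
    using continuous_attains_inf[OF compact_sphere, of 0 1 nrm] by blast
  have pos: "nrm x0 > 0"
  proof -
    have "x0 \<noteq> 0" using x0(1) by auto
    then have "0 \<le> nrm x0" "nrm x0 \<noteq> 0" using N unfolding is_norm_def by blast+
    then show ?thesis by simp
  qed
  have "norm x \<le> (1 / nrm x0) * nrm x" for x
  proof (cases "x = 0")
    case False
    then have "nrm x0 \<le> nrm ((1 / norm x) *\<^sub>R x)" by (intro x0) simp
    also have "\<dots> = nrm x / norm x" using N by (simp add: is_norm_def)
    finally show ?thesis using False pos by (simp add: field_simps)
  next
    case True
    moreover have "nrm 0 = 0" using N unfolding is_norm_def by blast
    ultimately show ?thesis by simp
  qed
  then show thesis using that[of "1 / nrm x0"] pos by simp
qed

text \<open>Bounds the set whose supremum defines \<open>induced_norm\<close>, so that the supremum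
  really is an upper bound. At the zero vector the quotient is 0 by the convention on
  division.\<close>

lemma induced_norm_bound_aux:
  fixes nrm :: "real^'n \<Rightarrow> real"
  assumes N: "is_norm nrm"
  obtains c where "c > 0" "\<And>M x. nrm (M *v x) / nrm x \<le> c * norm M"
proof -
  obtain b where b: "b > 0" "\<And>x. nrm x \<le> b * norm x" using is_norm_le_norm[OF N] by blast
  obtain c where c: "c > 0" "\<And>x. norm x \<le> c * nrm x" using norm_le_is_norm[OF N] by blast
  obtain d where d: "d > 0" "\<And>(M::real^'n^'n) (x::real^'n). norm (M *v x) \<le> norm M * norm x * d"
    using bounded_bilinear.pos_bounded[OF bounded_bilinear_matrix_vector_mult] by blast
  have "nrm (M *v x) / nrm x \<le> (b * d * c) * norm M" for M x
  proof (cases "nrm x = 0")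
    case False
    then have pos: "nrm x > 0" using N by (simp add: is_norm_def less_le)
    have "nrm (M *v x) \<le> b * (norm M * norm x * d)"
      using b d(2)[of M x] by (meson mult_left_mono order_less_imp_le order_trans)
    also have "\<dots> \<le> b * (norm M * (c * nrm x) * d)"
      using b c d by (intro mult_left_mono mult_right_mono) auto
    finally show ?thesis using pos by (simp add: pos_divide_le_eq mult_ac)
  qed (use b c d in simp)
  then show thesis using that[of "b * d * c"] b c d by simp
qed

lemma induced_norm_le:
  fixes nrm :: "real^'n \<Rightarrow> real"
  assumes N: "is_norm nrm"
  obtains c where "c > 0" "\<And>M. induced_norm nrm M \<le> c * norm M"
proof -
  obtain c where "c > 0" "\<And>M x. nrm (M *v x) / nrm x \<le> c * norm M"
    using induced_norm_bound_aux[OF N] by blast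
  then show thesis by (intro that[of c]) (auto simp: induced_norm_def intro!: cSUP_least)
qed

lemma is_norm_mult_le_induced_norm:
  fixes nrm :: "real^'n \<Rightarrow> real"
  assumes N: "is_norm nrm"
  shows "nrm (M *v x) \<le> induced_norm nrm M * nrm x"
proof (cases "x = 0")
  case False
  then have pos: "nrm x > 0" using N by (simp add: is_norm_def less_le)
  obtain c where "c > 0" "\<And>M x. nrm (M *v x) / nrm x \<le> c * norm M"
    using induced_norm_bound_aux[OF N] by blast
  then have "nrm (M *v x) / nrm x \<le> induced_norm nrm M"
    unfolding induced_norm_def by (intro cSUP_upper bdd_aboveI2) auto
  then show ?thesis using pos by (simp add: pos_divide_le_eq)
next
  case True
  moreover have "nrm 0 = 0" using N unfolding is_norm_def by blast
  ultimately show ?thesis by simp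
qed

text \<open>Each entry of \<open>M n\<close> is a component of its value at a basis vector, which
  the induced norm controls.\<close>

lemma induced_norm_tendsto_0:
  fixes nrm :: "real^'n \<Rightarrow> real"
  assumes N: "is_norm nrm" and M: "\<And>n. induced_norm nrm (M n) \<le> e n" and e: "e \<longlonglongrightarrow> 0"
  shows "M \<longlonglongrightarrow> 0"
proof (intro vec_tendstoI)
  fix i j :: 'n
  obtain c where c: "c > 0" "\<And>x. norm x \<le> c * nrm x" using norm_le_is_norm[OF N] by blast
  have *: "norm (M n $ i $ j) \<le> c * (e n * nrm (axis j 1))" for n
  proof -
    have "norm (M n $ i $ j) = norm ((M n *v axis j 1) $ i)"
      by (simp add: matrix_vector_mult_basis column_def)
    also have "\<dots> \<le> norm (M n *v axis j 1)" by (rule Finite_Cartesian_Product.norm_nth_le)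
    also have "\<dots> \<le> c * nrm (M n *v axis j 1)" by (rule c)
    also have "\<dots> \<le> c * (induced_norm nrm (M n) * nrm (axis j 1))"
      using c is_norm_mult_le_induced_norm[OF N] by (intro mult_left_mono) auto
    also have "\<dots> \<le> c * (e n * nrm (axis j 1))"
      using c M N by (intro mult_left_mono mult_right_mono) (auto simp: is_norm_def)
    finally show ?thesis .
  qed
  have "(\<lambda>n. c * (e n * nrm (axis j 1))) \<longlonglongrightarrow> c * (0 * nrm (axis j 1))"
    by (intro tendsto_intros e)
  then have "(\<lambda>n. c * (e n * nrm (axis j 1))) \<longlonglongrightarrow> 0" by simp
  from Lim_null_comparison[OF always_eventually[OF allI[OF *]] this]
  show "(\<lambda>n. M n $ i $ j) \<longlonglongrightarrow> 0 $ i $ j" by simp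
qed

subsection \<open>Multiplicatively periodic families\<close>

lemma norm_mult3_le:
  obtains d :: real where "d > 0"
    "\<And>(A::real^'n^'n) (B::real^'n^'n) (C::real^'n^'n). norm (A ** B ** C) \<le> d * norm A * norm B * norm C"
proof -
  obtain d where d: "d > 0" "\<And>(A::real^'n^'n) (B::real^'n^'n). norm (A ** B) \<le> norm A * norm B * d"
    using bounded_bilinear.pos_bounded[OF bounded_bilinear_matrix_mult] by blast
  have "norm (A ** B ** C) \<le> (d * d) * norm A * norm B * norm C" for A B C :: "real^'n^'n"
  proof -
    have "norm (A ** B ** C) \<le> norm (A ** B) * norm C * d" by (rule d)
    also have "\<dots> \<le> (norm A * norm B * d) * norm C * d"
      using d by (intro mult_right_mono) auto
    finally show ?thesis by (simp add: mult_ac)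
  qed
  moreover have "d * d > 0" using d by simp
  ultimately show thesis using that by blast
qed

text \<open>The exponent is the integer part of the logarithm of \<open>r\<close> to base \<theta>,
  that is, the number of whole periods contained in the ratio \<open>r\<close>.\<close>

lemma power_interval_exists:
  fixes \<theta> r :: real
  assumes "\<theta> > 1" "r \<ge> 1"
  obtains n where "\<theta> ^ n \<le> r" "r < \<theta> ^ Suc n"
proof -
  define N where "N = (LEAST n. r < \<theta> ^ n)"
  obtain m where "r < \<theta> ^ m" using real_arch_pow[OF assms(1)] by blast
  then have N: "r < \<theta> ^ N" unfolding N_def by (rule LeastI)
  then have "N \<noteq> 0" using assms by (intro notI) simp
  then obtain k where k: "N = Suc k" using not0_implies_Suc by blast
  then have "\<not> r < \<theta> ^ k" using not_less_Least[of k "\<lambda>n. r < \<theta> ^ n"] by (simp add: N_def)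
  then show thesis using that[of k] N k by simp
qed

text \<open>Translates decay in the number \<open>n\<close> of periods into decay in the ratio \<open>r\<close> of the
  values of the growth rate: the exponent is \<open>\<alpha> = - log\<^bsub>\<theta>\<^esub> \<rho>\<close>.\<close>

lemma power_le_powr:
  fixes \<theta> \<rho> :: real
  assumes "\<theta> > 1" "0 < \<rho>" "\<rho> < 1"
  obtains \<alpha> where "\<alpha> > 0"
    "\<And>n r. 1 \<le> r \<Longrightarrow> r < \<theta> ^ Suc n \<Longrightarrow> \<rho> ^ n \<le> 1 / \<rho> * r powr (- \<alpha>)"
proof -
  define \<alpha> where "\<alpha> = - ln \<rho> / ln \<theta>"
  have a: "\<alpha> > 0" using assms by (simp add: \<alpha>_def divide_neg_pos)
  have "\<rho> ^ n \<le> 1 / \<rho> * r powr (- \<alpha>)" if r: "1 \<le> r" "r < \<theta> ^ Suc n" for n r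
  proof -
    have "\<rho> = \<theta> powr (- \<alpha>)" using assms by (simp add: \<alpha>_def powr_def)
    \<comment> \<open>Only \<open>r < \<theta> ^ Suc n\<close> is available, so the comparison needs
      the exponent \<open>Suc n\<close>; the constant \<open>1 / \<rho>\<close> pays for the extra
      factor.\<close>
    then have "\<rho> ^ Suc n = (\<theta> powr (- \<alpha>)) ^ Suc n" by simp
    also have "\<dots> = (\<theta> ^ Suc n) powr (- \<alpha>)"
      using assms by (simp add: powr_powr powr_mult mult.commute flip: powr_realpow)
    also have "\<dots> \<le> r powr (- \<alpha>)" using r a by (intro powr_mono2') auto
    finally show ?thesis using assms by (simp add: field_simps)
  qed
  then show thesis using that a by blast
qed

text \<open>The differential equation is gone: continuity, invertibility and the multiplicative
  period are all that the estimates use.\<close>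

locale scale_periodic =
  fixes \<theta> :: real and Z :: "real \<Rightarrow> real^'n^'n" and V :: "real^'n^'n"
  assumes theta: "\<theta> > 1"
    and cont: "continuous_on {0<..} Z"
    and invZ: "y > 0 \<Longrightarrow> invertible (Z y)"
    and invV: "invertible V"
    and period: "y > 0 \<Longrightarrow> Z (y * \<theta>) = Z y ** V"
begin

lemma period_inv:
  assumes "y > 0"
  shows "matrix_inv (Z (y * \<theta>)) = matrix_inv V ** matrix_inv (Z y)"
proof (rule matrix_inv_unique)
  have "Z y ** (V ** matrix_inv V) ** matrix_inv (Z y) = mat 1"
    using invV invZ[OF assms] by (simp add: matrix_inv)
  then show "Z (y * \<theta>) ** (matrix_inv V ** matrix_inv (Z y)) = mat 1"
    using assms by (simp add: period matrix_mul_assoc)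
qed

lemma period_power:
  assumes "y > 0"
  shows "Z (y * \<theta> ^ n) ** Y = Z y ** lpow V n Y"
proof (induction n arbitrary: Y)
  case (Suc n)
  have "Z (y * \<theta> ^ Suc n) = Z (y * \<theta> ^ n) ** V"
    using period[of "y * \<theta> ^ n"] assms theta by (simp add: mult_ac)
  then show ?case using Suc[of "V ** Y"] by (simp add: lpow_Suc2 matrix_mul_assoc del: lpow.simps)
qed simp

text \<open>Counterpart of \<open>period_power\<close> for the second argument of a transition
  matrix: periods removed there become powers of \<open>matrix_inv V\<close>, which commutation
  moves to the left of \<open>Q\<close>.\<close>

lemma period_power_inv:
  assumes "y > 0" and comm: "V ** Q = Q ** V"
  shows "Q ** matrix_inv (Z (y * \<theta> ^ n)) = lpow (matrix_inv V) n Q ** matrix_inv (Z y)"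
proof (induction n)
  case (Suc n)
  have "matrix_inv (Z (y * \<theta> ^ Suc n)) = matrix_inv V ** matrix_inv (Z (y * \<theta> ^ n))"
    using period_inv[of "y * \<theta> ^ n"] assms theta by (simp add: mult_ac)
  moreover have "Q ** matrix_inv V = matrix_inv V ** Q"
    by (metis comm invV matrix_inv matrix_mul_assoc matrix_mul_lid matrix_mul_rid)
  ultimately have "Q ** matrix_inv (Z (y * \<theta> ^ Suc n))
      = matrix_inv V ** (Q ** matrix_inv (Z (y * \<theta> ^ n)))"
    by (simp add: matrix_mul_assoc)
  then show ?case using Suc by (simp add: matrix_mul_assoc)
qed simp

text \<open>Each common period inserts \<open>V M V^-1\<close>, which equals \<open>M\<close> by
  commutation. Both arguments can therefore be moved together.\<close>

lemma shift_invariant: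
  assumes "x > 0" "y > 0" and comm: "V ** M = M ** V"
  shows "Z (x * \<theta> ^ n) ** M ** matrix_inv (Z (y * \<theta> ^ n)) = Z x ** M ** matrix_inv (Z y)"
proof (induction n)
  case (Suc n)
  have "Z (x * \<theta> ^ Suc n) ** M ** matrix_inv (Z (y * \<theta> ^ Suc n))
      = (Z (x * \<theta> ^ n) ** V) ** M ** (matrix_inv V ** matrix_inv (Z (y * \<theta> ^ n)))"
    using period[of "x * \<theta> ^ n"] period_inv[of "y * \<theta> ^ n"] assms theta by (simp add: mult_ac)
  also have "\<dots> = Z (x * \<theta> ^ n) ** (V ** M) ** matrix_inv V ** matrix_inv (Z (y * \<theta> ^ n))"
    by (simp add: matrix_mul_assoc)
  also have "\<dots> = Z (x * \<theta> ^ n) ** M ** (V ** matrix_inv V) ** matrix_inv (Z (y * \<theta> ^ n))"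
    unfolding comm by (simp add: matrix_mul_assoc)
  finally show ?case using Suc invV by (simp add: matrix_inv)
qed simp

text \<open>A common shift brings \<open>y\<close> into one period, and \<open>x\<close> stays
  within a factor \<theta> of it; there continuity of \<open>Z\<close> and of its inverse on a
  compact interval gives the constant.\<close>

lemma comparable_bound:
  obtains C where "C \<ge> 0"
    "\<And>M x y. V ** M = M ** V \<Longrightarrow> 0 < x \<Longrightarrow> 0 < y \<Longrightarrow> x \<le> \<theta> * y \<Longrightarrow> y \<le> \<theta> * x \<Longrightarrow>
      norm (Z x ** M ** matrix_inv (Z y)) \<le> C * norm M"
proof -
  \<comment> \<open>For \<open>y\<close> between 1 and \<theta> and \<open>x\<close> within a factor
    \<theta> of \<open>y\<close>, both points lie in this interval.\<close>
  let ?I = "{1 / \<theta>..\<theta> * \<theta>}"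
  have I: "?I \<subseteq> {0<..}" using theta by (auto intro: less_le_trans[of 0 "1/\<theta>"])
  have "compact (Z ` ?I)"
    using continuous_on_subset[OF cont I] by (intro compact_continuous_image) auto
  then obtain B1 where B1: "\<And>x. x \<in> ?I \<Longrightarrow> norm (Z x) \<le> B1"
    using compact_imp_bounded bounded_iff by (metis image_eqI)
  have "continuous_on {0<..} (\<lambda>y. matrix_inv (Z y))"
    using cont invZ unfolding continuous_on_def by (auto intro!: tendsto_matrix_inv)
  then have "compact ((\<lambda>y. matrix_inv (Z y)) ` ?I)"
    using continuous_on_subset[OF _ I] by (intro compact_continuous_image) auto
  then obtain B2 where B2: "\<And>x. x \<in> ?I \<Longrightarrow> norm (matrix_inv (Z x)) \<le> B2"
    using compact_imp_bounded bounded_iff by (metis (mono_tags, lifting) image_eqI)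
  obtain d :: real where d: "d > 0"
    "\<And>(A::real^'n^'n) (B::real^'n^'n) (C::real^'n^'n). norm (A ** B ** C) \<le> d * norm A * norm B * norm C"
    using norm_mult3_le by blast
  have one: "1 \<in> ?I" using theta by (simp add: mult_ge1_I less_imp_le)
  then have B0: "0 \<le> B1" "0 \<le> B2" using B1 B2 norm_ge_zero order_trans by blast+
  have base: "norm (Z x ** M ** matrix_inv (Z y)) \<le> (d * B1 * B2) * norm M"
    if "1 \<le> y" "y \<le> \<theta>" "x \<le> \<theta> * y" "y \<le> \<theta> * x" for M x y
  proof -
    have "1 / \<theta> \<le> 1" using theta by simp
    have "\<theta> * y \<le> \<theta> * \<theta>" "\<theta> \<le> \<theta> * \<theta>" using that theta by auto
    moreover have "1 \<le> \<theta> * x" using that by linarith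
    then have "1 / \<theta> \<le> x" using theta by (simp add: field_simps)
    ultimately have "1 / \<theta> \<le> x" "x \<le> \<theta> * \<theta>" "1 / \<theta> \<le> y" "y \<le> \<theta> * \<theta>"
      using that \<open>1 / \<theta> \<le> 1\<close> by linarith+
    then have xy: "x \<in> ?I" "y \<in> ?I" by simp_all
    have "norm (Z x ** M ** matrix_inv (Z y)) \<le> d * norm (Z x) * norm M * norm (matrix_inv (Z y))"
      by (rule d)
    also have "\<dots> \<le> d * B1 * norm M * B2"
      using d B0 B1[OF xy(1)] B2[OF xy(2)] by (intro mult_mono mult_nonneg_nonneg) auto
    finally show ?thesis by (simp add: mult_ac)
  qed
  have "norm (Z x ** M ** matrix_inv (Z y)) \<le> (d * B1 * B2) * norm M"
    if M: "V ** M = M ** V" and xy: "0 < x" "0 < y" "x \<le> \<theta> * y" "y \<le> \<theta> * x" for M x y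
  proof (cases "y \<ge> 1")
    case True
    then obtain n where n: "\<theta> ^ n \<le> y" "y < \<theta> ^ Suc n" using power_interval_exists[OF theta] by blast
    define k where "k = \<theta> ^ n"
    have k: "k > 0" "k \<le> y" "y < \<theta> * k" using n theta by (simp_all add: k_def)
    have "norm (Z (x / k) ** M ** matrix_inv (Z (y / k))) \<le> (d * B1 * B2) * norm M"
      by (rule base) (use k xy in \<open>simp_all add: field_simps\<close>)
    moreover have "Z x ** M ** matrix_inv (Z y) = Z (x / k) ** M ** matrix_inv (Z (y / k))"
      using shift_invariant[OF _ _ M, of "x / k" "y / k" n] k xy unfolding k_def[symmetric] by simp
    ultimately show ?thesis by simp
  next
    case False
    then have "1 / y \<ge> 1" using xy by simp
    then obtain n where n: "\<theta> ^ n \<le> 1 / y" "1 / y < \<theta> ^ Suc n"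
      using power_interval_exists[OF theta] by blast
    \<comment> \<open>The exponent is \<open>Suc n\<close>, not \<open>n\<close>: multiplying
      \<open>y\<close> by this power lands it above 1 and at most at \<theta>.\<close>
    define k where "k = \<theta> ^ Suc n"
    have "\<theta> * \<theta> ^ n \<le> \<theta> * (1 / y)" using n theta by (intro mult_left_mono) auto
    then have k: "k > 0" "k * y \<le> \<theta>" "1 < k * y"
      using n theta xy by (simp_all add: k_def field_simps)
    have "norm (Z (x * k) ** M ** matrix_inv (Z (y * k))) \<le> (d * B1 * B2) * norm M"
      by (rule base) (use k xy in \<open>simp_all add: mult_ac\<close>)
    then show ?thesis
      using shift_invariant[OF xy(1,2) M, of "Suc n"] unfolding k_def[symmetric] by simp
  qed
  then show thesis using that[of "d * B1 * B2"] d B0 by simp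
qed

text \<open>The whole periods in the ratio are removed from the larger argument: from
  \<open>x\<close> they turn \<open>P\<close> into \<open>V^n P\<close>, from \<open>y\<close> they
  turn \<open>Q\<close> into \<open>V^-n Q\<close>. The remaining arguments are comparable, so
  \<open>comparable_bound\<close> applies and the powers supply the decay.\<close>

lemma dichotomy_bounds:
  assumes VP: "V ** P = P ** V" and VQ: "V ** Q = Q ** V"
    and P: "expdecay (\<lambda>n. lpow V n P)" and Q: "expdecay (\<lambda>n. lpow (matrix_inv V) n Q)"
  obtains K \<alpha> where "K \<ge> 0" "\<alpha> > 0"
    "\<And>x y. 0 < y \<Longrightarrow> y \<le> x \<Longrightarrow> norm (Z x ** P ** matrix_inv (Z y)) \<le> K * (x / y) powr (- \<alpha>)"
    "\<And>x y. 0 < x \<Longrightarrow> x \<le> y \<Longrightarrow> norm (Z x ** Q ** matrix_inv (Z y)) \<le> K * (y / x) powr (- \<alpha>)"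
proof -
  obtain C where C: "C \<ge> 0"
    "\<And>M x y. V ** M = M ** V \<Longrightarrow> 0 < x \<Longrightarrow> 0 < y \<Longrightarrow> x \<le> \<theta> * y \<Longrightarrow> y \<le> \<theta> * x \<Longrightarrow>
      norm (Z x ** M ** matrix_inv (Z y)) \<le> C * norm M"
    using comparable_bound by blast
  obtain D \<rho> where D: "0 \<le> D" "0 < \<rho>" "\<rho> < 1"
    "\<And>n. norm (lpow V n P) \<le> D * \<rho> ^ n" "\<And>n. norm (lpow (matrix_inv V) n Q) \<le> D * \<rho> ^ n"
    using expdecay_common_rate[OF P Q] by blast
  obtain \<alpha> where a: "\<alpha> > 0"
    "\<And>n r. 1 \<le> r \<Longrightarrow> r < \<theta> ^ Suc n \<Longrightarrow> \<rho> ^ n \<le> 1 / \<rho> * r powr (- \<alpha>)"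
    using power_le_powr[OF theta D(2,3)] by blast
  have bound: "C * (D * \<rho> ^ n) \<le> (C * D / \<rho>) * r powr (- \<alpha>)" if "1 \<le> r" "r < \<theta> ^ Suc n" for r n
    using mult_left_mono[OF a(2)[OF that], of "C * D"] C D by (simp add: mult_ac)
  have first: "norm (Z x ** P ** matrix_inv (Z y)) \<le> (C * D / \<rho>) * (x / y) powr (- \<alpha>)"
    if xy: "0 < y" "y \<le> x" for x y
  proof -
    have r: "x / y \<ge> 1" using xy by simp
    then obtain n where n: "\<theta> ^ n \<le> x / y" "x / y < \<theta> ^ Suc n"
      using power_interval_exists[OF theta] by blast
    define k where "k = \<theta> ^ n"
    have k: "k > 0" using theta by (simp add: k_def)
    have kx: "k * y \<le> x" "x < \<theta> * k * y" using n xy by (simp_all add: k_def field_simps)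
    have comm: "V ** lpow V n P = lpow V n P ** V"
      by (metis VP lpow.simps(2) lpow_Suc2 lpow_mult_right)
    have "Z x ** P = Z (x / k) ** lpow V n P"
      using period_power[of "x / k" n P] k xy unfolding k_def[symmetric] by simp
    then have "norm (Z x ** P ** matrix_inv (Z y)) = norm (Z (x / k) ** lpow V n P ** matrix_inv (Z y))"
      by simp
    also have "\<dots> \<le> C * norm (lpow V n P)"
    proof (rule C(2)[OF comm])
      have "x / k \<ge> y" using k kx by (simp add: field_simps)
      then show "y \<le> \<theta> * (x / k)" using theta xy k mult_mono[of 1 \<theta> y "x / k"] by simp
    qed (use k kx xy in \<open>auto simp: field_simps\<close>)
    also have "\<dots> \<le> C * (D * \<rho> ^ n)" using C D by (intro mult_left_mono) auto
    also have "\<dots> \<le> (C * D / \<rho>) * (x / y) powr (- \<alpha>)" using bound r n by blast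
    finally show ?thesis .
  qed
  have second: "norm (Z x ** Q ** matrix_inv (Z y)) \<le> (C * D / \<rho>) * (y / x) powr (- \<alpha>)"
    if xy: "0 < x" "x \<le> y" for x y
  proof -
    have r: "y / x \<ge> 1" using xy by simp
    then obtain n where n: "\<theta> ^ n \<le> y / x" "y / x < \<theta> ^ Suc n"
      using power_interval_exists[OF theta] by blast
    define k where "k = \<theta> ^ n"
    have k: "k > 0" using theta by (simp add: k_def)
    have kx: "k * x \<le> y" "y < \<theta> * k * x" using n xy by (simp_all add: k_def field_simps)
    have WV: "V ** matrix_inv V = matrix_inv V ** V" using invV by (simp add: matrix_inv)
    have comm: "V ** lpow (matrix_inv V) n Q = lpow (matrix_inv V) n Q ** V"
      using lpow_commute[OF WV[symmetric], of n Q] by (simp add: VQ lpow_mult_right)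
    have "Q ** matrix_inv (Z y) = lpow (matrix_inv V) n Q ** matrix_inv (Z (y / k))"
      using period_power_inv[of "y / k" Q n] VQ k xy unfolding k_def[symmetric] by simp
    then have "norm (Z x ** Q ** matrix_inv (Z y))
        = norm (Z x ** lpow (matrix_inv V) n Q ** matrix_inv (Z (y / k)))"
      by (simp flip: matrix_mul_assoc)
    also have "\<dots> \<le> C * norm (lpow (matrix_inv V) n Q)"
    proof (rule C(2)[OF comm])
      have "y / k \<ge> x" using k kx by (simp add: field_simps)
      then show "x \<le> \<theta> * (y / k)" using theta xy k mult_mono[of 1 \<theta> x "y / k"] by simp
    qed (use k kx xy in \<open>auto simp: field_simps\<close>)
    also have "\<dots> \<le> C * (D * \<rho> ^ n)" using C D by (intro mult_left_mono) auto
    also have "\<dots> \<le> (C * D / \<rho>) * (y / x) powr (- \<alpha>)" using bound r n by blast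
    finally show ?thesis .
  qed
  show thesis by (rule that[OF _ a(1) first second]) (use C D in auto)
qed

end

subsection \<open>Eigenvalues on the unit circle\<close>

text \<open>Allowing any \<open>Y\<close> that fixes \<open>v\<close> covers both the identity and a
  projection whose range contains \<open>v\<close>.\<close>

lemma lpow_eigenvector:
  fixes V Y :: "'a::field^'n^'n"
  assumes "V *v v = z *s v" "Y *v v = v"
  shows "lpow V n Y *v v = z ^ n *s v"
proof (induction n)
  case (Suc n)
  have "lpow V (Suc n) Y *v v = V *v (z ^ n *s v)"
    by (simp add: matrix_vector_mul_assoc[symmetric] Suc)
  also have "\<dots> = z ^ n *s (z *s v)" by (simp add: vec.scale assms)
  finally show ?case by (simp add: vector_smult_assoc mult.commute)
qed (use assms in simp)

lemma unimodular_power_tendsto_0: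
  fixes w :: "complex^'n"
  assumes "cmod z = 1" "(\<lambda>n. z ^ n *s w) \<longlonglongrightarrow> 0"
  shows "w = 0"
proof -
  have "norm (z ^ n *s w) = norm w" for n
    using assms(1) by (simp add: norm_vec_def norm_mult norm_power)
  then have "(\<lambda>n::nat. norm w) \<longlonglongrightarrow> 0" using tendsto_norm_zero[OF assms(2)] by simp
  then show ?thesis by (simp add: LIMSEQ_const_iff)
qed

subsection \<open>Dichotomy and hyperbolicity of the monodromy matrix\<close>

text \<open>The dichotomy is tested only between the unit \<open>\<tau> 0\<close> and the times
  \<open>\<tau> n\<close>, where transition matrices become powers of \<open>V\<close>. On an
  eigenvector of modulus one these powers preserve the norm, which contradicts decay.\<close>

lemma dichotomy_imp_hyperbolic:
  fixes nrm :: "real^'n \<Rightarrow> real" and X :: "real \<Rightarrow> real^'n^'n"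
  assumes N: "is_norm nrm" and J: "open J" "convex J" and X: "fundamental_matrix J A X"
    and h: "strict_mono_on J h" and \<tau>: "\<And>n. \<tau> n \<in> J" "\<And>n. h (\<tau> n) = \<theta> ^ n" and theta: "\<theta> > 1"
    and V: "invertible V" and period: "\<And>n (Y::real^'n^'n). X (\<tau> n) ** Y = X (\<tau> 0) ** lpow V n Y"
    and dich: "uniform_dichotomy nrm J h A" and eig: "complex_eigenvalue V z"
  shows "cmod z \<noteq> 1"
proof
  assume z: "cmod z = 1"
  obtain v where v: "v \<noteq> 0" "cmat V *v v = z *s v"
    using eig unfolding complex_eigenvalue_def by blast
  obtain P K \<alpha> where K: "K \<ge> 1" "\<alpha> > 0"
    and comm: "\<forall>t\<in>J. \<forall>s\<in>J. P t ** transition_matrix J A t s = transition_matrix J A t s ** P s"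
    and stable: "\<forall>t\<in>J. \<forall>s\<in>J. t \<ge> s \<longrightarrow>
      induced_norm nrm (transition_matrix J A t s ** P s) \<le> K * (h t / h s) powr (- \<alpha>)"
    and unstable: "\<forall>t\<in>J. \<forall>s\<in>J. s \<ge> t \<longrightarrow>
      induced_norm nrm (transition_matrix J A t s ** (mat 1 - P s)) \<le> K * (h s / h t) powr (- \<alpha>)"
    using dich unfolding uniform_dichotomy_def by blast
  define e where "e = \<tau> 0"
  have e: "e \<in> J" "h e = 1" using \<tau>(1)[of 0] \<tau>(2)[of 0] by (simp_all add: e_def)
  have tau_ge: "\<tau> n \<ge> e" for n
  proof (rule ccontr)
    assume "\<not> e \<le> \<tau> n"
    then have "\<theta> ^ n < 1" using strict_mono_onD[OF h \<tau>(1) e(1), of n] \<tau>(2)[of n] e(2) by simp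
    then show False using one_le_power[OF less_imp_le[OF theta], of n] by linarith
  qed
  have inv: "invertible (X t)" if "t \<in> J" for t using X that by (simp add: fundamental_matrix_def)
  note invX = matrix_inv[OF inv]
  note tm = transition_matrix_eq[OF J X]
  note VW = matrix_inv[OF V]
  have lim: "(\<lambda>n. K * (\<theta> ^ n) powr (- \<alpha>)) \<longlonglongrightarrow> 0"
  proof -
    have "\<theta> powr - \<alpha> < 1" using theta K by (simp add: powr_less_one)
    then have "(\<lambda>n. K * (\<theta> powr - \<alpha>) ^ n) \<longlonglongrightarrow> K * 0"
      by (intro tendsto_intros LIMSEQ_realpow_zero) auto
    moreover have "(\<theta> ^ n) powr (- \<alpha>) = (\<theta> powr - \<alpha>) ^ n" for n
      using theta by (simp add: powr_powr mult.commute flip: powr_realpow)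
    ultimately show ?thesis by simp
  qed
  define Z where "Z = X e"
  define Zi where "Zi = matrix_inv Z"
  have Z: "Z ** Zi = mat 1" "Zi ** Z = mat 1" using invX[OF e(1)] by (simp_all add: Z_def Zi_def)
  have per: "X (\<tau> n) ** Y = Z ** lpow V n Y" for n and Y :: "real^'n^'n" using period by (simp add: Z_def e_def)
  have "(\<lambda>n. transition_matrix J A (\<tau> n) e ** P e) \<longlonglongrightarrow> 0"
    by (rule induced_norm_tendsto_0[OF N _ lim]) (use stable \<tau> e tau_ge in fastforce)
  from bounded_linear.tendsto_zero[OF bounded_linear_matrix_mult_left this, of Z]
  have a: "(\<lambda>n. Z ** lpow V n (Zi ** P e ** Z)) \<longlonglongrightarrow> 0"
    by (simp add: tm[OF \<tau>(1) e(1)] Z_def[symmetric] Zi_def[symmetric] per lpow_mult_right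
        flip: matrix_mul_assoc)
  have "(\<lambda>n. transition_matrix J A e (\<tau> n) ** (mat 1 - P (\<tau> n))) \<longlonglongrightarrow> 0"
    by (rule induced_norm_tendsto_0[OF N _ lim]) (use unstable \<tau> e tau_ge in fastforce)
  \<comment> \<open>Invariance of the projections replaces the moving \<open>P (\<tau> n)\<close> by
    the fixed \<open>P e\<close>, so that one limit statement about \<open>P e\<close>
    results.\<close>
  moreover have "transition_matrix J A e (\<tau> n) ** (mat 1 - P (\<tau> n))
      = (mat 1 - P e) ** (Z ** lpow (matrix_inv V) n Zi)" for n
  proof -
    have "X (\<tau> n) ** lpow (matrix_inv V) n Zi = Z ** lpow V n (lpow (matrix_inv V) n Zi)"
      by (rule per)
    also have "lpow V n (lpow (matrix_inv V) n Zi) = Zi"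
    proof (induction n)
      case (Suc n)
      have "lpow V (Suc n) (lpow (matrix_inv V) (Suc n) Zi)
          = lpow V n ((V ** matrix_inv V) ** lpow (matrix_inv V) n Zi)"
        unfolding lpow_Suc2[of V] by (simp add: matrix_mul_assoc)
      then show ?case using Suc VW by simp
    qed simp
    finally have "matrix_inv (X (\<tau> n)) = lpow (matrix_inv V) n Zi"
      using Z by (intro matrix_inv_unique) simp
    then have "transition_matrix J A e (\<tau> n) = Z ** lpow (matrix_inv V) n Zi"
      by (simp add: tm[OF e(1) \<tau>(1)] Z_def)
    moreover have "transition_matrix J A e (\<tau> n) ** (mat 1 - P (\<tau> n))
        = (mat 1 - P e) ** transition_matrix J A e (\<tau> n)"
      using comm e(1) \<tau>(1)[of n] by (simp add: matrix_diff_ldistrib matrix_diff_rdistrib)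
    ultimately show ?thesis by simp
  qed
  ultimately have "(\<lambda>n. (mat 1 - P e) ** (Z ** lpow (matrix_inv V) n Zi)) \<longlonglongrightarrow> 0" by simp
  from bounded_linear.tendsto_zero[OF bounded_linear_matrix_mult_left this, of Z]
  have b: "(\<lambda>n. (mat 1 - P e) ** (Z ** lpow (matrix_inv V) n (mat 1))) \<longlonglongrightarrow> 0"
    by (simp add: lpow_mult_right[symmetric] Z flip: matrix_mul_assoc)
  have apply_v: "(\<lambda>n. cmat (M n) *v v) \<longlonglongrightarrow> 0" if "M \<longlonglongrightarrow> 0" for M :: "nat \<Rightarrow> real^'n^'n"
    by (intro bounded_linear.tendsto_zero[OF bounded_bilinear.bounded_linear_left[OF
          bounded_bilinear_matrix_vector_mult]] bounded_linear.tendsto_zero[OF bounded_linear_cmat] that)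
  have z0: "z \<noteq> 0" using z by auto
  \<comment> \<open>The value at time \<open>e\<close> of the complex solution with coordinate
    vector \<open>v\<close>.\<close>
  define w where "w = cmat Z *v v"
  have Ziw: "cmat Zi *v w = v"
    by (simp add: w_def matrix_vector_mul_assoc cmat_mult[symmetric] Z cmat_mat)
  have Wv: "cmat (matrix_inv V) *v v = (1 / z) *s v"
  proof -
    have "v = cmat (matrix_inv V) *v (cmat V *v v)"
      by (simp add: matrix_vector_mul_assoc cmat_mult[symmetric] VW cmat_mat)
    also have "\<dots> = z *s (cmat (matrix_inv V) *v v)" by (simp add: v vec.scale)
    finally have "(1 / z) *s v = (1 / z) *s (z *s (cmat (matrix_inv V) *v v))" by simp
    then show ?thesis using z0 by (simp add: vector_smult_assoc)
  qed
  have "cmat ((mat 1 - P e) ** (Z ** lpow (matrix_inv V) n (mat 1))) *v v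
      = (1 / z) ^ n *s (cmat (mat 1 - P e) *v w)" for n
    using lpow_eigenvector[OF Wv, of "mat 1" n]
    by (simp add: cmat_mult cmat_lpow cmat_mat w_def vec.scale flip: matrix_vector_mul_assoc)
  then have "(\<lambda>n. (1 / z) ^ n *s (cmat (mat 1 - P e) *v w)) \<longlonglongrightarrow> 0"
    using apply_v[OF b] by simp
  \<comment> \<open>Backward decay puts \<open>w\<close> in the range of \<open>P e\<close>; the
    forward limit \<open>a\<close> can then be applied to \<open>v\<close> and forces
    \<open>w = 0\<close>.\<close>
  then have "cmat (mat 1 - P e) *v w = 0"
    by (rule unimodular_power_tendsto_0[rotated]) (simp add: norm_divide z)
  then have "cmat (P e) *v w = w"
    by (simp add: cmat_diff cmat_mat matrix_vector_mult_diff_rdistrib)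
  then have "cmat (Zi ** P e ** Z) *v v = v"
    using Ziw by (simp add: cmat_mult w_def flip: matrix_vector_mul_assoc)
  then have "cmat (Z ** lpow V n (Zi ** P e ** Z)) *v v = z ^ n *s w" for n
    using lpow_eigenvector[OF v(2), of "cmat (Zi ** P e ** Z)" n]
    by (simp add: cmat_mult[of Z] cmat_lpow w_def vec.scale flip: matrix_vector_mul_assoc)
  then have "(\<lambda>n. z ^ n *s w) \<longlonglongrightarrow> 0" using apply_v[OF a] by simp
  then have "w = 0" by (rule unimodular_power_tendsto_0[OF z])
  then show False using Ziw v(1) by simp
qed

lemma (in scale_periodic) hyperbolic_imp_dichotomy:
  fixes nrm :: "real^'n \<Rightarrow> real"
  assumes N: "is_norm nrm" and J: "open J" "convex J" and X: "fundamental_matrix J A X"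
    and h: "strict_mono_on J h" "\<And>t. t \<in> J \<Longrightarrow> h t > 0" and XZ: "\<And>t. t \<in> J \<Longrightarrow> X t = Z (h t)"
    and hyp: "\<And>z. complex_eigenvalue V z \<Longrightarrow> cmod z \<noteq> 1"
  shows "uniform_dichotomy nrm J h A"
proof -
  obtain P where P: "P ** P = P" "V ** P = P ** V" "expdecay (\<lambda>n. lpow V n P)"
    "expdecay (\<lambda>n. lpow (matrix_inv V) n (mat 1 - P))"
    using real_spectral_projection[OF invV hyp] by blast
  define Q where "Q = mat 1 - P"
  have VQ: "V ** Q = Q ** V" using P by (simp add: Q_def matrix_diff_ldistrib matrix_diff_rdistrib)
  obtain K \<alpha> where K: "K \<ge> 0" "\<alpha> > 0"
    "\<And>x y. 0 < y \<Longrightarrow> y \<le> x \<Longrightarrow> norm (Z x ** P ** matrix_inv (Z y)) \<le> K * (x / y) powr (- \<alpha>)"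
    "\<And>x y. 0 < x \<Longrightarrow> x \<le> y \<Longrightarrow> norm (Z x ** Q ** matrix_inv (Z y)) \<le> K * (y / x) powr (- \<alpha>)"
    using dichotomy_bounds[OF P(2) VQ P(3) P(4)[folded Q_def]] by blast
  obtain c where c: "c > 0" "\<And>M. induced_norm nrm M \<le> c * norm M"
    using induced_norm_le[OF N] by blast
  \<comment> \<open>\<open>P\<close> acts on coordinates with respect to the columns of
    \<open>X\<close>; conjugation by \<open>X t\<close> makes it a projection of the state space at
    time \<open>t\<close>, invariant under the flow.\<close>
  define R where "R = (\<lambda>t. X t ** P ** matrix_inv (X t))"
  have inv: "invertible (X t)" if "t \<in> J" for t using X that by (simp add: fundamental_matrix_def)
  have cancel: "M ** matrix_inv (X t) ** X t = M" "M ** X t ** matrix_inv (X t) = M"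
    if "t \<in> J" for t and M :: "real^'n^'n"
    using matrix_inv[OF inv[OF that]] by (simp_all flip: matrix_mul_assoc)
  note tm = transition_matrix_eq[OF J X]
  have mono: "h s \<le> h t" if "t \<in> J" "s \<in> J" "s \<le> t" for s t
    using strict_mono_on_leD[OF h(1)] that by blast
  \<comment> \<open>The factor \<open>c\<close> passes from the Euclidean to the induced norm, and
    the maximum secures a dichotomy constant of at least 1.\<close>
  have scale: "c * (K * r) \<le> max 1 (c * K) * r" if "r \<ge> 0" for r
    using mult_right_mono[of "c * K" "max 1 (c * K)" r] that by (simp add: mult.assoc)
  show ?thesis unfolding uniform_dichotomy_def
  proof (intro exI conjI ballI impI)
    show "max 1 (c * K) \<ge> 1" "\<alpha> > 0" using K by auto
  next
    fix t assume t: "t \<in> J"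
    have "R t ** R t = X t ** (P ** P) ** matrix_inv (X t)"
      unfolding R_def by (simp add: matrix_mul_assoc cancel[OF t])
    then show "R t ** R t = R t" by (simp add: P R_def)
  next
    fix t s assume t: "t \<in> J" and s: "s \<in> J"
    show "R t ** transition_matrix J A t s = transition_matrix J A t s ** R s"
      unfolding R_def tm[OF t s] by (simp add: matrix_mul_assoc cancel[OF t] cancel[OF s])
    assume ts: "t \<ge> s"
    have "transition_matrix J A t s ** R s = Z (h t) ** P ** matrix_inv (Z (h s))"
      unfolding R_def tm[OF t s] by (simp add: matrix_mul_assoc cancel[OF s] XZ[OF t, symmetric] XZ[OF s, symmetric])
    then have "induced_norm nrm (transition_matrix J A t s ** R s)
        \<le> c * norm (Z (h t) ** P ** matrix_inv (Z (h s)))" using c by simp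
    also have "\<dots> \<le> c * (K * (h t / h s) powr (- \<alpha>))"
      using c K h(2)[OF s] mono[OF t s ts] by (intro mult_left_mono) auto
    also have "\<dots> \<le> max 1 (c * K) * (h t / h s) powr (- \<alpha>)" by (rule scale) simp
    finally show "induced_norm nrm (transition_matrix J A t s ** R s)
        \<le> max 1 (c * K) * (h t / h s) powr (- \<alpha>)" .
  next
    fix t s assume t: "t \<in> J" and s: "s \<in> J" and ts: "s \<ge> t"
    have "transition_matrix J A t s ** (mat 1 - R s) = Z (h t) ** Q ** matrix_inv (Z (h s))"
      unfolding R_def tm[OF t s] Q_def
      by (simp add: matrix_diff_ldistrib matrix_diff_rdistrib matrix_mul_assoc cancel[OF s]
          XZ[OF t, symmetric] XZ[OF s, symmetric])
    then have "induced_norm nrm (transition_matrix J A t s ** (mat 1 - R s))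
        \<le> c * norm (Z (h t) ** Q ** matrix_inv (Z (h s)))" using c by simp
    also have "\<dots> \<le> c * (K * (h s / h t) powr (- \<alpha>))"
      using c K h(2)[OF t] mono[OF s t ts] by (intro mult_left_mono) auto
    also have "\<dots> \<le> max 1 (c * K) * (h s / h t) powr (- \<alpha>)" by (rule scale) simp
    finally show "induced_norm nrm (transition_matrix J A t s ** (mat 1 - R s))
        \<le> max 1 (c * K) * (h s / h t) powr (- \<alpha>)" .
  qed
qed

theorem theorem3:
  fixes nrm :: "real^'n \<Rightarrow> real"
    and a0 :: ereal
    and J :: "real set"
    and h :: "real \<Rightarrow> real"
    and T :: real
    and A :: "real \<Rightarrow> real^'n^'n"
    and V :: "real^'n^'n"
  assumes "is_norm nrm"
    and "a0 < \<infinity>"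
    and "J = {t. a0 < ereal t}"
    and "differentiable_growth_rate J h"
    and "T > growth_unit J h"
    and "continuous_on J A"
    and "\<forall>t\<in>J. deriv h t \<noteq> 0"
    and "\<forall>t\<in>J. deriv (\<lambda>r. growth_mult J h r T) t *\<^sub>R A (growth_mult J h t T)
           = (deriv h t * h T / deriv h (growth_mult J h t T)) *\<^sub>R A (growth_mult J h t T)"
    and "\<forall>t\<in>J. (deriv h t * h T / deriv h (growth_mult J h t T)) *\<^sub>R A (growth_mult J h t T)
           = A t"
    and "monodromy_matrix J h T A V"
  shows "(\<forall>z. complex_eigenvalue V z \<longrightarrow> cmod z \<noteq> 1) \<longleftrightarrow> uniform_dichotomy nrm J h A"
proof -
  have J: "open J" "convex J"
  proof -
    have "open (ereal -` {a0<..})"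
      using open_vimage[of "{a0<..}" ereal] continuous_on_ereal[OF continuous_on_id] by simp
    moreover have "J = ereal -` {a0<..}" using assms(3) by auto
    ultimately show "open J" by simp
    show "convex J" unfolding assms(3) is_interval_convex_1[symmetric] is_interval_1
      by (auto intro: less_le_trans)
  qed
  obtain g where h: "strict_mono_on J h" and g: "homeomorphism J {0<..} h g"
    using assms(4) unfolding differentiable_growth_rate_def by blast
  define \<eta> where "\<eta> = inv_into J h"
  have hJ: "h ` J = {0<..}" using g by (simp add: homeomorphism_def)
  have injh: "inj_on h J" using h strict_mono_on_imp_inj_on by blast
  have eta: "\<eta> y \<in> J" "h (\<eta> y) = y" if "y > 0" for y
    using that hJ unfolding \<eta>_def by (auto intro!: inv_into_into f_inv_into_f)
  have eta_h: "\<eta> (h t) = t" if "t \<in> J" for t using that injh by (simp add: \<eta>_def)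
  have hpos: "h t > 0" if "t \<in> J" for t using that hJ by auto
  have "continuous_on {0<..} g" using g by (simp add: homeomorphism_def)
  moreover have "g y = \<eta> y" if "y \<in> {0<..}" for y
    using g that eta_h[of "g y"] unfolding homeomorphism_def by force
  ultimately have cont_eta: "continuous_on {0<..} \<eta>" by (rule continuous_on_eq)
  have "\<eta> 1 < T" using assms(5) by (simp add: growth_unit_def \<eta>_def)
  \<comment> \<open>\<open>J\<close> is an upper ray and \<open>T\<close> lies above the unit, so
    \<open>T\<close> belongs to \<open>J\<close>; monotonicity then makes \<open>h T\<close> a
    genuine expansion factor.\<close>
  then have TJ: "T \<in> J" using eta(1)[of 1] unfolding assms(3) by (auto intro: less_trans)
  have hT: "h T > 1" using strict_mono_onD[OF h eta(1) TJ \<open>\<eta> 1 < T\<close>] eta(2)[of 1] by simp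
  obtain X where V: "invertible V" and X: "fundamental_matrix J A X"
    and XV: "\<And>t. t \<in> J \<Longrightarrow> X (growth_mult J h t T) = X t ** V"
    using assms(10) unfolding monodromy_matrix_def by blast
  define Z where "Z = X \<circ> \<eta>"
  interpret scale_periodic "h T" Z V
  proof
    have "continuous_on J X"
      using X has_vector_derivative_continuous continuous_at_imp_continuous_on
      unfolding fundamental_matrix_def by blast
    then show "continuous_on {0<..} Z"
      unfolding Z_def using eta(1) by (intro continuous_on_compose cont_eta) (auto elim: continuous_on_subset)
    show "invertible (Z y)" if "y > 0" for y
      using X eta(1)[OF that] by (simp add: Z_def fundamental_matrix_def)
    show "Z (y * h T) = Z y ** V" if "y > 0" for y
      using XV[OF eta(1)[OF that]] eta(2)[OF that] by (simp add: Z_def growth_mult_def \<eta>_def)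
  qed (use hT V in auto)
  show ?thesis
  proof
    assume "\<forall>z. complex_eigenvalue V z \<longrightarrow> cmod z \<noteq> 1"
    then show "uniform_dichotomy nrm J h A"
      by (intro hyperbolic_imp_dichotomy[OF assms(1) J X h hpos]) (auto simp: Z_def eta_h)
  next
    assume dich: "uniform_dichotomy nrm J h A"
    have "cmod z \<noteq> 1" if "complex_eigenvalue V z" for z
    \<comment> \<open>The times used are \<open>\<eta> (h T ^ n)\<close>, the \<open>n\<close>-fold
      products of \<open>T\<close> in the group, starting from the unit at
      \<open>n = 0\<close>.\<close>
    proof (rule dichotomy_imp_hyperbolic[OF assms(1) J X h _ _ hT V _ dich that])
      show "\<eta> (h T ^ n) \<in> J" "h (\<eta> (h T ^ n)) = h T ^ n" for n using eta hT by simp_all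
      show "X (\<eta> (h T ^ n)) ** Y = X (\<eta> (h T ^ 0)) ** lpow V n Y" for n and Y :: "real^'n^'n"
        using period_power[of 1 n Y] by (simp add: Z_def)
    qed
    then show "\<forall>z. complex_eigenvalue V z \<longrightarrow> cmod z \<noteq> 1" by blast
  qed
qed

end
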